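(* Let $d\ge 1$ and let $P$ be a tiling space of $\mathbb{R}^d$ satisfying the following hypotheses: (1) the tiles are (triangulated) polyhedra that meet full-face to full-face; (2) there are only finitely many tile types up to translation (tiles that are rotations of one another count as different types); (3) $P$ is a closed, nonempty and translation-invariant subset of the space of all tilings of $\mathbb{R}^d$ that can be formed from these tiles. Then $P$ is a fiber bundle over the torus $T^d=\mathbb{R}^d/\mathbb{Z}^d$ with totally disconnected fiber; that is, there exist a totally disconnected space $F$ and a locally trivial continuous map $P\to T^d$ with fiber $F$.
   Context: Tiles and tilings. A prototile is a compact $d$-dimensional polyhedron in $\mathbb{R}^d$ (a polygon if $d=2$), homeomorphic to a closed ball, not necessarily convex, equipped with a fixed finite triangulation, and possibly carrying a mark (label); prototiles with different marks are considered different even if they have the same shape. Faces, edges and vertices of a tile refer to this triangulation. A finite set of prototiles is fixed; a tile is a translate of a prototile (with its triangulation and mark). A tiling is a collection of tiles whose union is $\mathbb{R}^d$, with pairwise disjoint interiors, meeting full-face to full-face: the intersection of any two tiles of the tiling is a (possibly empty) union of simplices that belong to the triangulations of both tiles, and the two triangulations agree there. Topology. $\mathbb{R}^d$ acts on tilings by translation. The space of all tilings by the given prototiles has the usual tiling topology: two tilings $T,T'$ are within $\varepsilon$ of each other if there are vectors $u,u'$ of norm at most $\varepsilon$ such that $T+u$ and $T'+u'$ agree (including marks) on the ball of radius $1/\varepsilon$ about the origin. A tiling space is a closed, nonempty, translation-invariant subset of the space of all tilings by a given finite set of prototiles, with the subspace topology. *)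

theory Defs
  imports "HOL-Analysis.Analysis"
begin

subsection \<open>Tiles and tilings\<close>

text \<open>A tile is a finite simplicial complex (its triangulation, all faces included) together
  with a mark. The region it occupies is the union of the complex. Unmarked tiles are the case
  where all marks are equal.\<close>

type_synonym ('n, 'm) tile = "(real, 'n) vec set set \<times> 'm"

type_synonym ('n, 'm) tiling = "('n, 'm) tile set"

definition triangulation_of :: "('n::finite, 'm) tile \<Rightarrow> (real ^ 'n) set set" where
  "triangulation_of t = fst t"

definition support :: "('n::finite, 'm) tile \<Rightarrow> (real ^ 'n) set" where
  "support t = \<Union>(triangulation_of t)"

text \<open>Compactness of the support follows from finiteness of the complex, and full
  dimension from the homeomorphism with the unit ball of the ambient space.\<close>

definition prototile :: "('n::finite, 'm) tile \<Rightarrow> bool" where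
  "prototile t \<longleftrightarrow>
     simplicial_complex (triangulation_of t) \<and>
     support t homeomorphic (cball 0 1 :: (real ^ 'n) set)"

definition translate_tile :: "real ^ 'n \<Rightarrow> ('n::finite, 'm) tile \<Rightarrow> ('n, 'm) tile" where
  "translate_tile u t = ((\<lambda>S. (+) u ` S) ` fst t, snd t)"

definition translate_tiling :: "real ^ 'n \<Rightarrow> ('n::finite, 'm) tiling \<Rightarrow> ('n, 'm) tiling" where
  "translate_tiling u T = translate_tile u ` T"

text \<open>The second conjunct says that both triangulations induce the same subdivision of the
  common region.\<close>

definition face_to_face :: "('n::finite, 'm) tile \<Rightarrow> ('n, 'm) tile \<Rightarrow> bool" where
  "face_to_face t t' \<longleftrightarrow>
     (\<exists>L \<subseteq> triangulation_of t \<inter> triangulation_of t'. support t \<inter> support t' = \<Union>L) \<and>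
     {S \<in> triangulation_of t. S \<subseteq> support t \<inter> support t'} =
     {S \<in> triangulation_of t'. S \<subseteq> support t \<inter> support t'}"

definition tilings :: "('n::finite, 'm) tile set \<Rightarrow> ('n, 'm) tiling set" where
  "tilings Pr = {T.
     (\<forall>t \<in> T. \<exists>p \<in> Pr. \<exists>u. t = translate_tile u p) \<and>
     (\<Union>t \<in> T. support t) = UNIV \<and>
     (\<forall>t \<in> T. \<forall>t' \<in> T. t \<noteq> t' \<longrightarrow>
        interior (support t) \<inter> interior (support t') = {} \<and> face_to_face t t')}"

subsection \<open>The tiling topology\<close>

text \<open>Two tilings agree on a ball if the same tiles, with marks and triangulations, meet it.
  Comparing the restrictions to the ball instead yields the same topology.\<close>

definition patch :: "('n::finite, 'm) tiling \<Rightarrow> (real ^ 'n) set \<Rightarrow> ('n, 'm) tile set" where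
  "patch T B = {t \<in> T. support t \<inter> B \<noteq> {}}"

definition tiling_close :: "real \<Rightarrow> ('n::finite, 'm) tiling \<Rightarrow> ('n, 'm) tiling \<Rightarrow> bool" where
  "tiling_close \<epsilon> T T' \<longleftrightarrow> (\<exists>u u'. norm u \<le> \<epsilon> \<and> norm u' \<le> \<epsilon> \<and>
     patch (translate_tiling u T) (cball 0 (1 / \<epsilon>)) =
     patch (translate_tiling u' T') (cball 0 (1 / \<epsilon>)))"

definition tiling_topology :: "('n::finite, 'm) tile set \<Rightarrow> ('n, 'm) tiling topology" where
  "tiling_topology Pr = topology (\<lambda>U. U \<subseteq> tilings Pr \<and>
     (\<forall>T \<in> U. \<exists>\<epsilon> > 0. \<forall>T' \<in> tilings Pr. tiling_close \<epsilon> T T' \<longrightarrow> T' \<in> U))"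

lemma patch_restrict:
  assumes "patch T B = patch T' B" "A \<subseteq> B"
  shows "patch T A = patch T' A"
proof -
  have "patch S A = {t \<in> patch S B. support t \<inter> A \<noteq> {}}" for S :: "('a, 'b) tiling"
    using assms(2) by (auto simp: patch_def)
  then show ?thesis
    using assms(1) by simp
qed

lemma tiling_close_mono:
  assumes "tiling_close \<epsilon> T T'" "0 < \<epsilon>" "\<epsilon> \<le> \<delta>"
  shows "tiling_close \<delta> T T'"
proof -
  from assms(1) obtain u u' where u: "norm u \<le> \<epsilon>" "norm u' \<le> \<epsilon>"
    and eq: "patch (translate_tiling u T) (cball 0 (1 / \<epsilon>)) =
             patch (translate_tiling u' T') (cball 0 (1 / \<epsilon>))"
    unfolding tiling_close_def by blast
  have "1 / \<delta> \<le> 1 / \<epsilon>"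
    using assms(2,3) by (simp add: frac_le)
  then have "patch (translate_tiling u T) (cball 0 (1 / \<delta>)) =
             patch (translate_tiling u' T') (cball 0 (1 / \<delta>))"
    by (intro patch_restrict[OF eq] subset_cball)
  with u assms(3) show ?thesis
    unfolding tiling_close_def by (meson order_trans)
qed

lemma istopology_tiling:
  "istopology (\<lambda>U. U \<subseteq> tilings Pr \<and>
     (\<forall>T \<in> U. \<exists>\<epsilon> > 0. \<forall>T' \<in> tilings Pr. tiling_close \<epsilon> T T' \<longrightarrow> T' \<in> U))"
  (is "istopology ?P")
  unfolding istopology_def
proof (intro conjI allI impI)
  fix U V assume U: "?P U" and V: "?P V"
  show "U \<inter> V \<subseteq> tilings Pr"
    using U by blast
  show "\<forall>T \<in> U \<inter> V. \<exists>\<epsilon> > 0. \<forall>T' \<in> tilings Pr. tiling_close \<epsilon> T T' \<longrightarrow> T' \<in> U \<inter> V"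
  proof
    fix T assume T: "T \<in> U \<inter> V"
    obtain a where a: "a > 0" "\<forall>T' \<in> tilings Pr. tiling_close a T T' \<longrightarrow> T' \<in> U"
      using T U by blast
    obtain b where b: "b > 0" "\<forall>T' \<in> tilings Pr. tiling_close b T T' \<longrightarrow> T' \<in> V"
      using T V by blast
    have "tiling_close a T T' \<and> tiling_close b T T'" if "tiling_close (min a b) T T'" for T'
      using tiling_close_mono[OF that] a(1) b(1) by simp
    then show "\<exists>\<epsilon> > 0. \<forall>T' \<in> tilings Pr. tiling_close \<epsilon> T T' \<longrightarrow> T' \<in> U \<inter> V"
      using a b by (intro exI[of _ "min a b"]) auto
  qed
next
  fix K assume K: "\<forall>U \<in> K. ?P U"
  then show "\<Union>K \<subseteq> tilings Pr"
    by blast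
  show "\<forall>T \<in> \<Union>K. \<exists>\<epsilon> > 0. \<forall>T' \<in> tilings Pr. tiling_close \<epsilon> T T' \<longrightarrow> T' \<in> \<Union>K"
    using K by (meson UnionE UnionI)
qed

lemma openin_tiling_topology:
  "openin (tiling_topology Pr) U \<longleftrightarrow> U \<subseteq> tilings Pr \<and>
     (\<forall>T \<in> U. \<exists>\<epsilon> > 0. \<forall>T' \<in> tilings Pr. tiling_close \<epsilon> T T' \<longrightarrow> T' \<in> U)"
  unfolding tiling_topology_def by (simp add: topology_inverse'[OF istopology_tiling])

lemma topspace_tiling_topology: "topspace (tiling_topology Pr) = tilings Pr"
proof -
  have "openin (tiling_topology Pr) (tilings Pr)"
    unfolding openin_tiling_topology using zero_less_one by blast
  then show ?thesis
    by (meson openin_subset openin_tiling_topology openin_topspace subset_antisym)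
qed

definition tiling_space :: "('n::finite, 'm) tile set \<Rightarrow> ('n, 'm) tiling set \<Rightarrow> bool" where
  "tiling_space Pr P \<longleftrightarrow>
     closedin (tiling_topology Pr) P \<and> P \<noteq> {} \<and>
     (\<forall>T \<in> P. \<forall>u. translate_tiling u T \<in> P)"

subsection \<open>The torus\<close>

definition torus_proj :: "real ^ 'n \<Rightarrow> (real ^ 'n::finite) set" where
  "torus_proj x = {x + z |z. \<forall>i. z $ i \<in> \<int>}"

definition torus :: "(real ^ 'n::finite) set topology" where
  "torus = topology (\<lambda>U. U \<subseteq> range torus_proj \<and> open (torus_proj -` U))"

lemma openin_torus:
  fixes U :: "(real ^ 'n::finite) set set"
  shows "openin torus U \<longleftrightarrow> U \<subseteq> range torus_proj \<and> open (torus_proj -` U)"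
proof -
  have "istopology (\<lambda>U :: (real ^ 'n) set set. U \<subseteq> range torus_proj \<and> open (torus_proj -` U))"
    unfolding istopology_def by (auto simp: vimage_Union)
  then show ?thesis
    unfolding torus_def by (simp add: topology_inverse')
qed

lemma topspace_torus: "topspace torus = range torus_proj"
proof -
  have "openin torus (range torus_proj)"
    unfolding openin_torus by (simp add: vimage_def)
  then show ?thesis
    by (meson openin_subset openin_torus openin_topspace subset_antisym)
qed

lemma quotient_map_torus_proj: "quotient_map euclidean torus torus_proj"
  unfolding quotient_map_def topspace_torus openin_torus by (auto simp: vimage_def)

subsection \<open>Fiber bundles\<close>

definition totally_disconnected_space :: "'a topology \<Rightarrow> bool" where
  "totally_disconnected_space X \<longleftrightarrow> (\<forall>S. connectedin X S \<longrightarrow> (\<exists>a. S \<subseteq> {a}))"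

definition fiber_bundle ::
    "'e topology \<Rightarrow> 'b topology \<Rightarrow> 'f topology \<Rightarrow> ('e \<Rightarrow> 'b) \<Rightarrow> bool" where
  "fiber_bundle E B F p \<longleftrightarrow>
     continuous_map E B p \<and>
     (\<forall>b \<in> topspace B. \<exists>U h. openin B U \<and> b \<in> U \<and>
        homeomorphic_map (subtopology E {e \<in> topspace E. p e \<in> U})
                         (prod_topology (subtopology B U) F) h \<and>
        (\<forall>e \<in> topspace E. p e \<in> U \<longrightarrow> fst (h e) = p e))"

end

theory Submission
  imports Defs
begin

text \<open>Perturb the edge vectors of the tiles to rational vectors by an additive map
  \<open>\<Phi>\<close>, so that all linear relations over the rationals among them survive, and rescale by
  \<open>N\<close> so that \<open>\<Phi>\<close> sends edge vectors to integer vectors. Applying \<open>\<Phi>\<close> to the vertices of a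
  tiling and interpolating affinely on simplices deforms space by a homeomorphism close to
  multiplication by \<open>N\<close>, and the deformed vertices all lie in one coset of the integer
  lattice. The position of the deformed origin relative to that coset is the bundle map to the
  torus. Translations, reparametrised by the deformation, form an action of the vector group
  that covers the rotation action on the torus, whence local triviality. Two close tilings in
  the same fiber differ by a small translation preserving the phase, so they agree on a large
  ball, and the fiber is totally disconnected.\<close>

subsection \<open>Rational approximation\<close>

text \<open>The obstacle is that \<open>\<Phi>\<close> is only additive. It reaches all vectors
  through a Hamel basis and may be wildly discontinuous, so it is close to multiplication by
  \<open>N\<close> on the edge vectors but has no bound elsewhere. Hence no estimate involves
  \<open>\<Phi> u\<close> for a translation vector \<open>u\<close>: only differences
  \<open>deform T x - deform T y\<close> are estimated, and values of \<open>\<Phi>\<close> enter by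
  exact cancellation. What global additivity buys is that translates of a simplex are deformed alike
  and that different edge paths to a vertex give the same image. The error on each simplex is kept
  at \<open>N / 2\<close>, so that the deformation is \<open>N\<close> times the identity plus a
  perturbation with half that Lipschitz constant, which the contraction principle inverts. An
  ordinary translation would move the phase by an amount that depends on the tiling. Measuring time
  in the deformed space removes this dependence. No space of deformed tilings is formed: the tilings
  in \<open>P\<close> stay as they are, and only the time change is used.\<close>

lemma Rats_common_denominator:
  fixes A :: "real set"
  assumes "finite A" "A \<subseteq> \<rat>"
  shows "\<exists>N::nat. 0 < N \<and> (\<forall>x\<in>A. real N * x \<in> \<int>)"
  using assms
proof (induction A rule: finite_induct)
  case empty
  then show ?case by auto
next
  case (insert a A)
  then obtain N :: nat where N: "0 < N" "\<And>x. x \<in> A \<Longrightarrow> real N * x \<in> \<int>" by auto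
  from insert.prems have "a \<in> \<rat>" by simp
  then obtain p :: int and q :: nat where q: "q \<noteq> 0" "a = real_of_int p / real q"
    unfolding Rats_eq_int_div_nat by blast
  have "real (N * q) * x \<in> \<int>" if "x \<in> insert a A" for x
  proof (cases "x = a")
    case True
    then have "real (N * q) * x = of_int (int N * p)" using q by simp
    then show ?thesis by (metis Ints_of_int)
  next
    case False
    then have "real N * x \<in> \<int>" using that N(2) by blast
    then have "real q * (real N * x) \<in> \<int>" by (rule Ints_mult[OF Ints_of_nat])
    then show ?thesis by (simp add: mult_ac)
  qed
  then show ?case using N(1) q(1) by (intro exI[of _ "N * q"]) auto
qed

text \<open>A rational basis of the span of \<open>D\<close> may be moved to nearby rational numbers, and the
  remaining elements of \<open>D\<close> follow with fixed rational coefficients.\<close>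

lemma additive_rational_approximation:
  fixes D :: "real set" and \<epsilon> :: real
  assumes "finite D" "0 < \<epsilon>"
  obtains \<psi> :: "real \<Rightarrow> real" where "\<And>x y. \<psi> (x + y) = \<psi> x + \<psi> y"
    and "\<And>x. x \<in> D \<Longrightarrow> \<psi> x \<in> \<rat>" and "\<And>x. x \<in> D \<Longrightarrow> \<bar>\<psi> x - x\<bar> \<le> \<epsilon>"
proof -
  interpret Q: vector_space "\<lambda>(q::rat) (x::real). of_rat q * x"
    by unfold_locales (simp_all add: algebra_simps of_rat_add of_rat_mult)
  interpret QQ: vector_space_pair "\<lambda>(q::rat) (x::real). of_rat q * x"
    "\<lambda>(q::rat) (x::real). of_rat q * x" ..
  obtain B where B: "B \<subseteq> D" "Q.independent B" "D \<subseteq> Q.span B"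
    using Q.maximal_independent_subset by blast
  have finB: "finite B" using B(1) assms(1) finite_subset by blast
  have "\<forall>x\<in>D. \<exists>q. x = (\<Sum>b\<in>B. of_rat (q b) * b)"
    using B(3) unfolding Q.span_finite[OF finB] by blast
  then obtain q where q: "\<And>x. x \<in> D \<Longrightarrow> x = (\<Sum>b\<in>B. of_rat (q x b) * b)" by metis
  \<comment> \<open>Moving each basis element by at most \<open>\<epsilon> / M\<close> moves an
    element of \<open>D\<close> by at most the sum of its absolute coefficients times
    \<open>\<epsilon> / M\<close>. The summand 1 keeps \<open>M\<close> positive when
    \<open>D\<close> is empty.\<close>
  define M where "M = 1 + (\<Sum>x\<in>D. \<Sum>b\<in>B. \<bar>real_of_rat (q x b)\<bar>)"
  have M: "0 < M" unfolding M_def by (intro add_pos_nonneg sum_nonneg) auto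
  have "\<exists>r\<in>\<rat>. \<bar>r - b\<bar> \<le> \<epsilon> / M" for b
  proof -
    have "b < b + \<epsilon> / M" using M assms(2) by simp
    then obtain r where "r \<in> \<rat>" "b < r" "r < b + \<epsilon> / M" using Rats_dense_in_real by blast
    then show ?thesis by (intro bexI[of _ r]) auto
  qed
  then obtain r where r: "\<And>b. r b \<in> \<rat>" "\<And>b. \<bar>r b - b\<bar> \<le> \<epsilon> / M" by metis
  \<comment> \<open>Extending from \<open>B\<close> to all reals completes \<open>B\<close> to a
    Hamel basis over the rationals; \<open>g\<close> is controlled on \<open>D\<close> only.\<close>
  obtain g where lin: "Vector_Spaces.linear (\<lambda>(q::rat) (x::real). of_rat q * x)
      (\<lambda>(q::rat) (x::real). of_rat q * x) g" and g: "\<And>b. b \<in> B \<Longrightarrow> g b = r b"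
    using QQ.linear_independent_extend[OF B(2), of r] by blast
  interpret g: Vector_Spaces.linear "\<lambda>(q::rat) (x::real). of_rat q * x"
      "\<lambda>(q::rat) (x::real). of_rat q * x" g by (fact lin)
  have gq: "g x = (\<Sum>b\<in>B. of_rat (q x b) * r b)" if "x \<in> D" for x
  proof -
    have "g x = g (\<Sum>b\<in>B. of_rat (q x b) * b)" using q[OF that] by simp
    also have "\<dots> = (\<Sum>b\<in>B. of_rat (q x b) * r b)"
      by (simp add: g.sum g.scale g)
    finally show ?thesis .
  qed
  show ?thesis
  proof
    show "g (x + y) = g x + g y" for x y by (rule g.add)
    show "g x \<in> \<rat>" if "x \<in> D" for x
      unfolding gq[OF that] using r(1) by (intro Rats_sum Rats_mult) auto
    show "\<bar>g x - x\<bar> \<le> \<epsilon>" if "x \<in> D" for x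
    proof -
      have "g x - x = (\<Sum>b\<in>B. of_rat (q x b) * (r b - b))"
        using gq[OF that] q[OF that] by (simp add: algebra_simps sum_subtractf)
      also have "\<bar>\<dots>\<bar> \<le> (\<Sum>b\<in>B. \<bar>real_of_rat (q x b)\<bar> * (\<epsilon> / M))"
        by (intro order_trans[OF sum_abs] sum_mono)
          (simp only: abs_mult, intro mult_left_mono r abs_ge_zero)
      also have "\<dots> = (\<Sum>b\<in>B. \<bar>real_of_rat (q x b)\<bar>) * (\<epsilon> / M)"
        by (simp only: sum_distrib_right)
      also have "\<dots> \<le> M * (\<epsilon> / M)"
      proof (rule mult_right_mono)
        have "(\<Sum>b\<in>B. \<bar>real_of_rat (q x b)\<bar>) \<le> (\<Sum>x\<in>D. \<Sum>b\<in>B. \<bar>real_of_rat (q x b)\<bar>)"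
          by (rule member_le_sum[OF that]) (auto intro: sum_nonneg assms)
        then show "(\<Sum>b\<in>B. \<bar>real_of_rat (q x b)\<bar>) \<le> M" unfolding M_def by simp
      qed (use M assms in auto)
      finally show ?thesis using M by simp
    qed
  qed
qed

section \<open>The integer lattice and approximation by lattice vectors\<close>

definition int_lattice :: "(real ^ 'n::finite) set" where
  "int_lattice = {z. \<forall>i. z $ i \<in> \<int>}"

lemma int_lattice_0 [simp]: "0 \<in> int_lattice"
  and int_lattice_add: "x \<in> int_lattice \<Longrightarrow> y \<in> int_lattice \<Longrightarrow> x + y \<in> int_lattice"
  and int_lattice_diff: "x \<in> int_lattice \<Longrightarrow> y \<in> int_lattice \<Longrightarrow> x - y \<in> int_lattice"
  by (auto simp: int_lattice_def)

lemma int_lattice_minus: "x - y \<in> int_lattice \<Longrightarrow> y - x \<in> int_lattice"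
  using int_lattice_diff[of 0 "x - y"] by simp

lemma int_lattice_eq_0:
  assumes "z \<in> int_lattice" "norm z < 1"
  shows "z = 0"
proof -
  have "z $ i = 0" for i
  proof -
    have "\<bar>z $ i\<bar> < 1" using component_le_norm_cart[of z i] assms(2) by linarith
    moreover have "z $ i \<in> \<int>" using assms(1) by (simp add: int_lattice_def)
    ultimately show ?thesis using Ints_nonzero_abs_less1 by blast
  qed
  then show ?thesis by (simp add: vec_eq_iff)
qed

text \<open>One additive function serves every coordinate, because \<open>D'\<close> collects the
  coordinates of all vectors in \<open>D\<close>. The denominator \<open>N\<close> is known only
  after the accuracy has been fixed, so the error is stated relative to \<open>N\<close>.\<close>

lemma additive_lattice_approximation:
  fixes D :: "(real ^ 'n::finite) set" and \<epsilon> :: real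
  assumes "finite D" "0 < \<epsilon>"
  obtains \<Phi> :: "real ^ 'n \<Rightarrow> real ^ 'n" and N :: real
  where "\<And>x y. \<Phi> (x + y) = \<Phi> x + \<Phi> y" "0 < N"
    "\<And>x. x \<in> D \<Longrightarrow> \<Phi> x \<in> int_lattice" "\<And>x. x \<in> D \<Longrightarrow> norm (\<Phi> x - N *\<^sub>R x) \<le> N * \<epsilon>"
proof -
  define D' where "D' = (\<Union>x\<in>D. range (\<lambda>i. x $ i))"
  have "finite D'" unfolding D'_def using assms(1) by auto
  \<comment> \<open>The norm is bounded below by the sum of the absolute coordinates, hence the
    division by the dimension.\<close>
  moreover have "0 < \<epsilon> / CARD('n)" using assms(2) by simp
  ultimately obtain \<psi> where \<psi>: "\<And>x y. \<psi> (x + y) = \<psi> x + \<psi> y"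
    "\<And>x. x \<in> D' \<Longrightarrow> \<psi> x \<in> \<rat>" "\<And>x. x \<in> D' \<Longrightarrow> \<bar>\<psi> x - x\<bar> \<le> \<epsilon> / CARD('n)"
    using additive_rational_approximation by blast
  have "finite (\<psi> ` D')" "\<psi> ` D' \<subseteq> \<rat>" using \<open>finite D'\<close> \<psi>(2) by auto
  then obtain N :: nat where N: "0 < N" "\<And>x. x \<in> D' \<Longrightarrow> real N * \<psi> x \<in> \<int>"
    using Rats_common_denominator[of "\<psi> ` D'"] by (metis imageI)
  show ?thesis
  proof
    let ?\<Phi> = "\<lambda>x::real^'n. \<chi> i. real N * \<psi> (x $ i)"
    show "?\<Phi> (x + y) = ?\<Phi> x + ?\<Phi> y" for x y
      by (simp add: vec_eq_iff \<psi>(1) algebra_simps)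
    show "0 < real N" using N by simp
    fix x assume x: "x \<in> D"
    then have xi: "x $ i \<in> D'" for i unfolding D'_def by auto
    show "?\<Phi> x \<in> int_lattice" unfolding int_lattice_def using N(2) xi by simp
    have "norm (?\<Phi> x - real N *\<^sub>R x) \<le> (\<Sum>i\<in>UNIV. \<bar>(?\<Phi> x - real N *\<^sub>R x) $ i\<bar>)"
      by (rule norm_le_l1_cart)
    also have "\<dots> \<le> (\<Sum>i\<in>(UNIV::'n set). real N * (\<epsilon> / CARD('n)))"
    proof (rule sum_mono)
      fix i :: 'n
      have "(?\<Phi> x - real N *\<^sub>R x) $ i = real N * (\<psi> (x $ i) - x $ i)"
        by (simp add: algebra_simps)
      then show "\<bar>(?\<Phi> x - real N *\<^sub>R x) $ i\<bar> \<le> real N * (\<epsilon> / CARD('n))"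
        using \<psi>(3)[OF xi, of i] N(1) by (simp only: abs_mult abs_of_nat, intro mult_left_mono) auto
    qed
    also have "\<dots> = real N * \<epsilon>" by simp
    finally show "norm (?\<Phi> x - real N *\<^sub>R x) \<le> real N * \<epsilon>" .
  qed
qed

text \<open>Barycentric coordinates are Lipschitz functions of the point; \<open>\<mu>\<close>
  stands for the difference of two coordinate vectors.\<close>

lemma affine_independent_coefficient_bound:
  fixes V :: "'a::euclidean_space set"
  assumes "\<not> affine_dependent V"
  obtains C where "0 \<le> C"
    "\<And>\<mu> v. sum \<mu> V = 0 \<Longrightarrow> v \<in> V \<Longrightarrow> \<bar>\<mu> v\<bar> \<le> C * norm (\<Sum>w\<in>V. \<mu> w *\<^sub>R w)"
proof -
  have fin: "finite V" using assms aff_independent_finite by blast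
  have "\<exists>C\<ge>0. \<forall>\<mu>. sum \<mu> V = 0 \<longrightarrow> \<bar>\<mu> v\<bar> \<le> C * norm (\<Sum>w\<in>V. \<mu> w *\<^sub>R w)" if v: "v \<in> V" for v
  proof -
    have "independent ((\<lambda>x. - v + x) ` (V - {v}))"
      using assms affine_dependent_iff_dependent2[OF v] by blast
    \<comment> \<open>The functional reads off the coefficient at \<open>v\<close>: after recentring
      at \<open>v\<close> it sums the coefficients at all other points, which is
      \<open>- \<mu> v\<close> since the total is zero.\<close>
    then obtain g :: "'a \<Rightarrow> real" where g: "linear g" "\<And>w. w \<in> V - {v} \<Longrightarrow> g (- v + w) = 1"
      using linear_independent_extend[of "(\<lambda>x. - v + x) ` (V - {v})" "\<lambda>_. 1"] by blast
    obtain B where B: "0 < B" "\<And>x. norm (g x) \<le> B * norm x"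
      using linear_bounded_pos[OF g(1)] by blast
    have "\<bar>\<mu> v\<bar> \<le> B * norm (\<Sum>w\<in>V. \<mu> w *\<^sub>R w)" if "sum \<mu> V = 0" for \<mu>
    proof -
      have "(\<Sum>w\<in>V. \<mu> w *\<^sub>R w) = (\<Sum>w\<in>V. \<mu> w *\<^sub>R (- v + w))"
        using that by (simp add: scaleR_right_diff_distrib sum_subtractf flip: scaleR_sum_left)
      then have "g (\<Sum>w\<in>V. \<mu> w *\<^sub>R w) = (\<Sum>w\<in>V. \<mu> w * g (- v + w))"
        using g(1) by (simp add: linear_sum linear_cmul)
      also have "\<dots> = (\<Sum>w\<in>V - {v}. \<mu> w * g (- v + w))"
        using g(1) by (subst sum.remove[OF fin v]) (simp add: linear_0)
      also have "\<dots> = (\<Sum>w\<in>V - {v}. \<mu> w)" using g(2) by (intro sum.cong) auto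
      also have "\<dots> = - \<mu> v" using that sum.remove[OF fin v, of \<mu>] by simp
      finally show ?thesis using B(2)[of "\<Sum>w\<in>V. \<mu> w *\<^sub>R w"] by simp
    qed
    then show ?thesis using B(1) by (intro exI[of _ B]) auto
  qed
  then obtain C where C: "\<And>v. v \<in> V \<Longrightarrow> 0 \<le> C v"
    "\<And>v \<mu>. v \<in> V \<Longrightarrow> sum \<mu> V = 0 \<Longrightarrow> \<bar>\<mu> v\<bar> \<le> C v * norm (\<Sum>w\<in>V. \<mu> w *\<^sub>R w)"
    by metis
  show ?thesis
  proof
    show "0 \<le> sum C V" using C(1) by (intro sum_nonneg)
    fix \<mu> :: "'a \<Rightarrow> real" and v assume *: "sum \<mu> V = 0" "v \<in> V"
    have "C v \<le> sum C V" using member_le_sum[OF \<open>v \<in> V\<close>, of C] C(1) fin by auto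
    then show "\<bar>\<mu> v\<bar> \<le> sum C V * norm (\<Sum>w\<in>V. \<mu> w *\<^sub>R w)"
      using C(2)[OF *(2,1)] by (meson mult_right_mono norm_ge_zero order_trans)
  qed
qed

subsection \<open>Piecewise affine deformations\<close>

text \<open>The graph over \<open>S\<close> of the affine map that takes the same values as \<open>f\<close> at the vertices.\<close>

definition affine_graph ::
    "('a::real_vector \<Rightarrow> 'b::real_vector) \<Rightarrow> 'a set \<Rightarrow> ('a \<times> 'b) set" where
  "affine_graph f S = convex hull ((\<lambda>v. (v, f v)) ` {v. v extreme_point_of S})"

lemma fst_affine_graph:
  fixes S :: "'a::euclidean_space set"
  assumes "compact S" "convex S"
  shows "fst ` affine_graph f S = S"
  unfolding affine_graph_def convex_hull_linear_image[OF linear_fst] image_image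
  using Krein_Milman_Minkowski[OF assms] by simp

text \<open>Both graphs over two simplices contain the graph over a shared face, which is what makes
  neighbouring interpolations compatible.\<close>

lemma affine_graph_face:
  assumes "F face_of S"
  shows "affine_graph f F \<subseteq> affine_graph f S"
  unfolding affine_graph_def using extreme_point_of_face[OF assms]
  by (intro hull_mono) auto

text \<open>Tiles are translated by arbitrary vectors, which is why \<open>\<Phi>\<close> has to be
  additive on the whole space and not merely on edge vectors.\<close>

lemma affine_graph_translation:
  assumes "\<And>x y. f (x + y) = f x + f y"
  shows "affine_graph f ((+) u ` S) = (+) (u, f u) ` affine_graph f S"
proof -
  have "(\<lambda>v. (v, f v)) ` {v. v extreme_point_of ((+) u ` S)} =
    (+) (u, f u) ` (\<lambda>v. (v, f v)) ` {v. v extreme_point_of S}"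
    unfolding extreme_points_of_translation by (simp add: image_image assms)
  then show ?thesis unfolding affine_graph_def by (simp add: convex_hull_translation)
qed

lemma affine_graph_coefficients:
  assumes "(x, y) \<in> affine_graph f S" "finite {v. v extreme_point_of S}"
  obtains a where "(\<Sum>v | v extreme_point_of S. a v) = 1"
    "x = (\<Sum>v | v extreme_point_of S. a v *\<^sub>R v)" "y = (\<Sum>v | v extreme_point_of S. a v *\<^sub>R f v)"
proof -
  let ?V = "{v. v extreme_point_of S}" and ?g = "\<lambda>v. (v, f v)"
  have inj: "inj_on ?g ?V" by (auto simp: inj_on_def)
  obtain u where u: "sum u (?g ` ?V) = 1" "(\<Sum>z\<in>?g ` ?V. u z *\<^sub>R z) = (x, y)"
    using assms unfolding affine_graph_def by (auto simp: convex_hull_finite)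
  have *: "(\<Sum>v\<in>?V. u (v, f v) *\<^sub>R (v, f v)) = (x, y)"
    using u(2) by (simp add: sum.reindex[OF inj])
  show ?thesis
  proof
    show "(\<Sum>v\<in>?V. u (v, f v)) = 1" using u(1) by (simp add: sum.reindex[OF inj])
    show "x = (\<Sum>v\<in>?V. u (v, f v) *\<^sub>R v)" using arg_cong[OF *, of fst] by (simp add: fst_sum)
    show "y = (\<Sum>v\<in>?V. u (v, f v) *\<^sub>R f v)" using arg_cong[OF *, of snd] by (simp add: snd_sum)
  qed
qed

text \<open>The order of quantifiers matters: \<open>C\<close> depends on the shape of
  \<open>S\<close> alone, so the tolerance \<open>\<eta>\<close> and the map \<open>f\<close> can be
  chosen after it. The error between two graph points is a combination of the errors on edges, with
  coefficients bounded by a multiple of \<open>norm (x - x')\<close>.\<close>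

lemma affine_graph_near_scaling:
  fixes S :: "'a::euclidean_space set"
  assumes "n simplex S"
  obtains C where "0 \<le> C" "\<And>f N \<eta> x y x' y'.
    (\<And>v w. v extreme_point_of S \<Longrightarrow> w extreme_point_of S \<Longrightarrow>
       norm (f v - f w - N *\<^sub>R (v - w)) \<le> \<eta>) \<Longrightarrow>
    (x, y) \<in> affine_graph f S \<Longrightarrow> (x', y') \<in> affine_graph f S \<Longrightarrow>
    norm (y - y' - N *\<^sub>R (x - x')) \<le> C * \<eta> * norm (x - x')"
proof -
  obtain V where V: "\<not> affine_dependent V" "S = convex hull V"
    using assms unfolding simplex_def by blast
  have ext: "{v. v extreme_point_of S} = V"
    using extreme_point_of_convex_hull_affine_independent[OF V(1)] V(2) by auto
  have fin: "finite V" using V(1) aff_independent_finite by blast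
  obtain C where C: "0 \<le> C" "\<And>\<mu> v. sum \<mu> V = 0 \<Longrightarrow> v \<in> V \<Longrightarrow>
      \<bar>\<mu> v\<bar> \<le> C * norm (\<Sum>w\<in>V. \<mu> w *\<^sub>R w)"
    using affine_independent_coefficient_bound[OF V(1)] by metis
  show ?thesis
  proof
    show "0 \<le> real (card V) * C" using C by simp
    fix f :: "'a \<Rightarrow> 'a" and N \<eta> x y x' y'
    assume near: "\<And>v w. v extreme_point_of S \<Longrightarrow> w extreme_point_of S \<Longrightarrow>
       norm (f v - f w - N *\<^sub>R (v - w)) \<le> \<eta>"
      and xy: "(x, y) \<in> affine_graph f S" and xy': "(x', y') \<in> affine_graph f S"
    obtain a where l: "sum a V = 1" "x = (\<Sum>v\<in>V. a v *\<^sub>R v)" "y = (\<Sum>v\<in>V. a v *\<^sub>R f v)"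
      using affine_graph_coefficients[OF xy] unfolding ext using fin by blast
    obtain b where l': "sum b V = 1" "x' = (\<Sum>v\<in>V. b v *\<^sub>R v)" "y' = (\<Sum>v\<in>V. b v *\<^sub>R f v)"
      using affine_graph_coefficients[OF xy'] unfolding ext using fin by blast
    define \<mu> where "\<mu> v = a v - b v" for v
    have \<mu>0: "sum \<mu> V = 0" using l l' by (simp add: \<mu>_def sum_subtractf)
    have \<mu>x: "(\<Sum>v\<in>V. \<mu> v *\<^sub>R v) = x - x'" and \<mu>y: "(\<Sum>v\<in>V. \<mu> v *\<^sub>R f v) = y - y'"
      using l l' by (simp_all add: \<mu>_def sum_subtractf scaleR_left_diff_distrib)
    \<comment> \<open>Comparing all vertices with one base vertex \<open>v0\<close> costs nothing,
      since the coefficients \<open>\<mu>\<close> sum to zero.\<close>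
    obtain v0 where v0: "v0 \<in> V" using l(1) by fastforce
    have "\<mu> v *\<^sub>R (f v - f v0 - N *\<^sub>R (v - v0)) =
        \<mu> v *\<^sub>R f v - N *\<^sub>R (\<mu> v *\<^sub>R v) - \<mu> v *\<^sub>R (f v0 - N *\<^sub>R v0)" for v
      by (simp add: algebra_simps)
    then have "(\<Sum>v\<in>V. \<mu> v *\<^sub>R (f v - f v0 - N *\<^sub>R (v - v0))) =
        (\<Sum>v\<in>V. \<mu> v *\<^sub>R f v) - N *\<^sub>R (\<Sum>v\<in>V. \<mu> v *\<^sub>R v) - sum \<mu> V *\<^sub>R (f v0 - N *\<^sub>R v0)"
      by (simp add: sum_subtractf scaleR_sum_right flip: scaleR_sum_left)
    then have "y - y' - N *\<^sub>R (x - x') = (\<Sum>v\<in>V. \<mu> v *\<^sub>R (f v - f v0 - N *\<^sub>R (v - v0)))"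
      using \<mu>0 \<mu>x \<mu>y by simp
    also have "norm \<dots> \<le> (\<Sum>v\<in>V. (C * norm (x - x')) * \<eta>)"
    proof (intro sum_norm_le)
      fix v assume v: "v \<in> V"
      have "\<bar>\<mu> v\<bar> \<le> C * norm (x - x')" using C(2)[OF \<mu>0 v] unfolding \<mu>x .
      moreover have "norm (f v - f v0 - N *\<^sub>R (v - v0)) \<le> \<eta>" using near v v0 ext by blast
      ultimately show "norm (\<mu> v *\<^sub>R (f v - f v0 - N *\<^sub>R (v - v0))) \<le> C * norm (x - x') * \<eta>"
        unfolding norm_scaleR using C(1) by (intro mult_mono) auto
    qed
    finally show "norm (y - y' - N *\<^sub>R (x - x')) \<le> real (card V) * C * \<eta> * norm (x - x')"
      by (simp add: mult_ac)
  qed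
qed

subsection \<open>Local finiteness\<close>

lemma translate_tile_translate: "translate_tile u (translate_tile v t) = translate_tile (u + v) t"
  by (simp add: translate_tile_def image_image add.assoc)

lemma translate_tile_0 [simp]: "translate_tile 0 t = t"
  by (simp add: translate_tile_def)

lemma translate_tiling_translate:
  "translate_tiling u (translate_tiling v T) = translate_tiling (u + v) T"
  by (simp add: translate_tiling_def image_image translate_tile_translate)

lemma translate_tiling_0 [simp]: "translate_tiling 0 T = T"
  by (simp add: translate_tiling_def)

lemma support_translate: "support (translate_tile u t) = (+) u ` support t"
  by (auto simp: support_def triangulation_of_def translate_tile_def)

lemma patch_translate:
  "patch (translate_tiling u T) B = translate_tile u ` patch T ((+) (- u) ` B)"
proof -
  have "support (translate_tile u t) \<inter> B \<noteq> {} \<longleftrightarrow> support t \<inter> (+) (- u) ` B \<noteq> {}" for t :: "('a, 'b) tile"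
  proof -
    have "(+) (- u) ` (support (translate_tile u t) \<inter> B) = support t \<inter> (+) (- u) ` B"
      unfolding support_translate by (subst image_Int) (auto simp: image_image)
    then show ?thesis by (metis image_is_empty)
  qed
  then show ?thesis unfolding patch_def translate_tiling_def by blast
qed

lemma patch_cball_translate:
  assumes "patch T (cball 0 R) = patch T' (cball 0 R)" "norm u + r \<le> R"
  shows "patch (translate_tiling u T) (cball 0 r) = patch (translate_tiling u T') (cball 0 r)"
proof -
  have "(+) (- u) ` cball 0 r \<subseteq> cball 0 R"
  proof
    fix x assume "x \<in> (+) (- u) ` cball 0 r"
    then obtain y where "norm y \<le> r" "x = - u + y" by auto
    then show "x \<in> cball 0 R" using norm_triangle_ineq4[of y u] assms(2) by simp
  qed
  then show ?thesis unfolding patch_translate using patch_restrict[OF assms(1)] by simp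
qed

text \<open>By invariance of domain, the homeomorphic image of the open unit ball is open in the
  space of the same dimension.\<close>

lemma prototile_support:
  fixes p :: "('n::finite, 'm) tile"
  assumes "prototile p"
  shows "compact (support p)" "interior (support p) \<noteq> {}"
proof -
  have hom: "support p homeomorphic (cball 0 1 :: (real ^ 'n) set)"
    using assms by (simp add: prototile_def)
  then show "compact (support p)" using homeomorphic_compactness compact_cball by blast
  from hom obtain f g where f: "homeomorphism (cball 0 1 :: (real ^ 'n) set) (support p) f g"
    by (meson homeomorphic_def homeomorphic_sym)
  have "open (f ` ball 0 1)"
  proof (rule invariance_of_domain)
    show "continuous_on (ball 0 1) f"
      using homeomorphism_cont1[OF f] ball_subset_cball continuous_on_subset by blast
    show "inj_on f (ball 0 1)"
      using homeomorphism_apply1[OF f] ball_subset_cball by (intro inj_on_inverseI[of _ g]) blast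
  qed simp
  moreover have "f ` ball 0 1 \<subseteq> support p"
    using homeomorphism_image1[OF f] ball_subset_cball by blast
  moreover have "f ` ball 0 1 \<noteq> {}" by simp
  ultimately show "interior (support p) \<noteq> {}" using interior_maximal by blast
qed

text \<open>Copies of one prototile have disjoint interiors, each containing a ball of radius
  \<open>r\<close>, so their translation vectors are separated by \<open>r\<close>. A bounded
  separated set is finite.\<close>

lemma finite_patch:
  fixes T :: "('n::finite, 'm) tiling"
  assumes "finite Pr" "\<forall>t\<in>Pr. prototile t" "T \<in> tilings Pr" "bounded B"
  shows "finite (patch T B)"
proof -
  have "finite {t \<in> patch T B. \<exists>u. t = translate_tile u p}" (is "finite ?Q") if p: "p \<in> Pr" for p
  proof -
    have pp: "prototile p" using p assms by blast
    obtain c r where cr: "0 < r" "ball c r \<subseteq> interior (support p)"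
      using prototile_support(2)[OF pp] by (meson ex_in_conv open_contains_ball open_interior)
    have "\<forall>t\<in>?Q. \<exists>u. t = translate_tile u p" by blast
    from bchoice[OF this] obtain u where u: "\<And>t. t \<in> ?Q \<Longrightarrow> t = translate_tile (u t) p" by blast
    have eq: "t = t'" if "t \<in> ?Q" "t' \<in> ?Q" "dist (u t) (u t') < r" for t t'
    proof (rule ccontr)
      assume "t \<noteq> t'"
      moreover have "t \<in> T" "t' \<in> T" using that by (auto simp: patch_def)
      ultimately have "interior (support t) \<inter> interior (support t') = {}"
        using assms(3) unfolding tilings_def by blast
      moreover have "interior (support s) = (+) (u s) ` interior (support p)" if "s \<in> ?Q" for s
        using u[OF that] support_translate[of "u s" p] by (simp add: interior_translation)
      moreover have "u t + c \<in> (+) (u t) ` interior (support p)"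
        using cr centre_in_ball[of c r] by (intro imageI) blast
      \<comment> \<open>If the vectors were closer than \<open>r\<close>, the point
        \<open>u t + c\<close> would be interior to both copies.\<close>
      moreover have "u t + c - u t' \<in> ball c r" using that(3)
        by (simp add: dist_norm norm_minus_commute algebra_simps)
      then have "u t + c \<in> (+) (u t') ` interior (support p)"
        using cr by (intro image_eqI[of _ _ "u t + c - u t'"]) auto
      ultimately show False using that by blast
    qed
    have "uniform_discrete (u ` ?Q)"
      unfolding uniform_discrete_def
    proof (intro exI[of _ r] conjI ballI impI cr(1))
      fix x y assume "x \<in> u ` ?Q" "y \<in> u ` ?Q" and d: "dist x y < r"
      then obtain t t' where t: "t \<in> ?Q" "x = u t" "t' \<in> ?Q" "y = u t'" by (elim imageE)
      then show "x = y" using eq[OF t(1,3)] d by simp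
    qed
    moreover have "bounded (u ` ?Q)"
    proof -
      obtain a where a: "\<And>x. x \<in> B \<Longrightarrow> norm x \<le> a" using assms(4) unfolding bounded_iff by blast
      obtain b where b: "\<And>x. x \<in> support p \<Longrightarrow> norm x \<le> b"
        using compact_imp_bounded[OF prototile_support(1)[OF pp]] unfolding bounded_iff by blast
      have "norm (u t) \<le> a + b" if t: "t \<in> ?Q" for t
      proof -
        obtain x where x: "x \<in> support t" "x \<in> B" using t by (auto simp: patch_def)
        then have "x \<in> (+) (u t) ` support p" using u[OF t] support_translate[of "u t" p] by simp
        then obtain y where y: "y \<in> support p" "x = u t + y" by blast
        then show ?thesis using a[OF x(2)] b[OF y(1)] norm_triangle_ineq4[of x y] by simp
      qed
      then show ?thesis unfolding bounded_iff by blast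
    qed
    ultimately have "finite (u ` ?Q)" using uniform_discrete_finite_iff by blast
    moreover have "inj_on u ?Q" using eq cr(1) by (intro inj_onI) simp
    ultimately show ?thesis by (rule finite_imageD)
  qed
  then have "finite (\<Union>p\<in>Pr. {t \<in> patch T B. \<exists>u. t = translate_tile u p})"
    using assms(1) by blast
  moreover have "patch T B \<subseteq> (\<Union>p\<in>Pr. {t \<in> patch T B. \<exists>u. t = translate_tile u p})"
    using assms(3) by (auto simp: patch_def tilings_def)
  ultimately show ?thesis by (rule rev_finite_subset)
qed

subsection \<open>Deforming a tiling\<close>

definition simplices :: "('n::finite, 'm) tiling \<Rightarrow> (real ^ 'n) set set" where
  "simplices T = \<Union>(fst ` T)"

definition vertices :: "('n::finite, 'm) tiling \<Rightarrow> (real ^ 'n) set" where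
  "vertices T = {v. \<exists>S\<in>simplices T. v extreme_point_of S}"

lemma simplices_translate: "simplices (translate_tiling u T) = (`) ((+) u) ` simplices T"
  by (auto simp: simplices_def translate_tiling_def translate_tile_def)

lemma vertices_translate: "vertices (translate_tiling u T) = (+) u ` vertices T"
proof -
  have "vertices T' = (\<Union>S\<in>simplices T'. {v. v extreme_point_of S})" for T' :: "('a, 'b) tiling"
    by (auto simp: vertices_def)
  then show ?thesis by (auto simp: simplices_translate extreme_points_of_translation)
qed

text \<open>The metric and lattice conditions on \<open>\<Phi>\<close> concern the finitely many
  prototile simplices; additivity carries them to every simplex of every tiling. A factor below
  \<open>N\<close> in \<open>near_scaling\<close> makes the deformation invertible, and
  \<open>N / 2\<close> gives contraction by one half.\<close>

locale lattice_deformation =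
  fixes Pr :: "('n::finite, 'm) tile set" and P :: "('n, 'm) tiling set"
    and \<Phi> :: "real ^ 'n \<Rightarrow> real ^ 'n" and N :: real
  assumes finite_Pr: "finite Pr"
    and prototile: "\<And>p. p \<in> Pr \<Longrightarrow> prototile p"
    and P_closed: "closedin (tiling_topology Pr) P"
    and P_translate: "\<And>T u. T \<in> P \<Longrightarrow> translate_tiling u T \<in> P"
    and add: "\<And>x y. \<Phi> (x + y) = \<Phi> x + \<Phi> y"
    and N_pos: "0 < N"
    and lattice: "\<And>p S v w. p \<in> Pr \<Longrightarrow> S \<in> fst p \<Longrightarrow> v extreme_point_of S \<Longrightarrow>
      w extreme_point_of S \<Longrightarrow> \<Phi> v - \<Phi> w \<in> int_lattice"
    and near_scaling: "\<And>p S x y x' y'. p \<in> Pr \<Longrightarrow> S \<in> fst p \<Longrightarrow> (x, y) \<in> affine_graph \<Phi> S \<Longrightarrow>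
      (x', y') \<in> affine_graph \<Phi> S \<Longrightarrow> norm (y - y' - N *\<^sub>R (x - x')) \<le> N / 2 * norm (x - x')"
begin

section \<open>The deformation is well defined and close to a scaling\<close>

lemma P_tilings: "P \<subseteq> tilings Pr"
  using closedin_subset[OF P_closed] by (simp add: topspace_tiling_topology)

lemma zero: "\<Phi> 0 = 0"
  using add[of 0 0] by simp

lemma diff: "\<Phi> (x - y) = \<Phi> x - \<Phi> y"
  using add[of "x - y" y] by simp

lemma tile_cases:
  assumes "T \<in> P" "t \<in> T"
  obtains p u where "p \<in> Pr" "t = translate_tile u p"
proof -
  have "\<forall>t\<in>T. \<exists>p\<in>Pr. \<exists>u. t = translate_tile u p"
    using assms(1) P_tilings by (auto simp: tilings_def)
  then show ?thesis using assms(2) that by blast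
qed

lemma simplices_cases:
  assumes "T \<in> P" "t \<in> T" "S \<in> fst t"
  obtains p u S0 where "p \<in> Pr" "t = translate_tile u p" "S0 \<in> fst p" "S = (+) u ` S0"
proof -
  obtain p u where p: "p \<in> Pr" "t = translate_tile u p" using tile_cases[OF assms(1,2)] .
  then obtain S0 where "S0 \<in> fst p" "S = (+) u ` S0"
    using assms(3) by (auto simp: translate_tile_def)
  then show ?thesis using that p by blast
qed

lemma prototile_complex: "p \<in> Pr \<Longrightarrow> simplicial_complex (fst p)"
  using prototile by (simp add: prototile_def triangulation_of_def)

lemma simplices_convex_compact:
  assumes "T \<in> P" "S \<in> simplices T"
  shows "convex S" "compact S"
proof -
  obtain t where "t \<in> T" "S \<in> fst t" using assms(2) by (auto simp: simplices_def)
  then obtain p u S0 where p: "p \<in> Pr" "S0 \<in> fst p" "S = (+) u ` S0"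
    using simplices_cases[OF assms(1)] by metis
  then obtain n where "n simplex S0"
    using prototile_complex unfolding simplicial_complex_def by blast
  then show "convex S" "compact S"
    using p(3) convex_simplex compact_simplex convex_translation compact_translation by blast+
qed

lemma simplices_Int_face:
  assumes "T \<in> P" "t \<in> T" "S \<in> fst t" "S' \<in> fst t"
  shows "S \<inter> S' face_of S"
proof -
  obtain p u where p: "p \<in> Pr" "t = translate_tile u p"
    using simplices_cases[OF assms(1-3)] by metis
  then obtain S0 S0' where S: "S0 \<in> fst p" "S = (+) u ` S0" "S0' \<in> fst p" "S' = (+) u ` S0'"
    using assms(3,4) by (auto simp: translate_tile_def)
  then have "S0 \<inter> S0' face_of S0"
    using prototile_complex[OF p(1)] unfolding simplicial_complex_def by blast
  moreover have "S \<inter> S' = (+) u ` (S0 \<inter> S0')" unfolding S by (rule image_Int[symmetric]) simp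
  ultimately show ?thesis using S by simp
qed

text \<open>Simplices of different tiles are compared through a simplex \<open>K\<close> of both
  triangulations that contains \<open>x\<close>. Then each intersection takes place inside a single
  complex, where it is a face of both sides; \<open>S \<inter> S'\<close> itself is never
  analysed.\<close>

lemma common_simplex:
  assumes T: "T \<in> P" and S: "S \<in> simplices T" "S' \<in> simplices T" and x: "x \<in> S" "x \<in> S'"
  obtains K where "K \<in> simplices T" "x \<in> K" "K \<inter> S face_of S" "K \<inter> S face_of K"
    "K \<inter> S' face_of S'" "K \<inter> S' face_of K"
proof -
  obtain t t' where t: "t \<in> T" "S \<in> fst t" "t' \<in> T" "S' \<in> fst t'"
    using S by (auto simp: simplices_def)
  obtain K where K: "x \<in> K" "K \<in> fst t" "K \<in> fst t'"
  proof (cases "t = t'")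
    case True
    then show ?thesis using that x t by blast
  next
    case False
    then have "face_to_face t t'" using t T P_tilings unfolding tilings_def by blast
    moreover have "x \<in> support t \<inter> support t'"
      using x t by (auto simp: support_def triangulation_of_def)
    ultimately show ?thesis
      using that unfolding face_to_face_def triangulation_of_def by blast
  qed
  show ?thesis
  proof
    show "K \<in> simplices T" using K t by (auto simp: simplices_def)
    show "K \<inter> S face_of K" "K \<inter> S' face_of K" using K t simplices_Int_face[OF T] by metis+
    show "K \<inter> S face_of S" "K \<inter> S' face_of S'"
      using K t simplices_Int_face[OF T, of _ S K] simplices_Int_face[OF T, of _ S' K]
      by (auto simp only: Int_commute)
  qed (rule K)
qed

lemma simplex_near_scaling:
  assumes "T \<in> P" "S \<in> simplices T" "(x, y) \<in> affine_graph \<Phi> S" "(x', y') \<in> affine_graph \<Phi> S"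
  shows "norm (y - y' - N *\<^sub>R (x - x')) \<le> N / 2 * norm (x - x')"
proof -
  obtain t where "t \<in> T" "S \<in> fst t" using assms(2) by (auto simp: simplices_def)
  then obtain p u S0 where p: "p \<in> Pr" "S0 \<in> fst p" "S = (+) u ` S0"
    using simplices_cases[OF assms(1)] by metis
  then have G: "affine_graph \<Phi> S = (+) (u, \<Phi> u) ` affine_graph \<Phi> S0"
    using affine_graph_translation add by blast
  obtain a b a' b' where "(a, b) \<in> affine_graph \<Phi> S0" "x = u + a" "y = \<Phi> u + b"
    "(a', b') \<in> affine_graph \<Phi> S0" "x' = u + a'" "y' = \<Phi> u + b'"
    using assms(3,4) unfolding G by auto
  then show ?thesis using near_scaling[OF p(1,2), of a b a' b'] by simp
qed

lemma fst_affine_graph_simplices: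
  assumes "T \<in> P" "S \<in> simplices T"
  shows "fst ` affine_graph \<Phi> S = S"
  using fst_affine_graph simplices_convex_compact[OF assms] by blast

text \<open>The union of the graphs over all simplices, read as a function; that it is single-valued
  for tilings in \<open>P\<close> is the content of \<open>deform_eqI\<close>.\<close>

definition deform :: "('n, 'm) tiling \<Rightarrow> real ^ 'n \<Rightarrow> real ^ 'n" where
  "deform T x = (THE y. \<exists>S\<in>simplices T. (x, y) \<in> affine_graph \<Phi> S)"

lemma deform_eqI:
  assumes T: "T \<in> P" and S: "S \<in> simplices T" and xy: "(x, y) \<in> affine_graph \<Phi> S"
  shows "deform T x = y"
  unfolding deform_def
proof (rule the_equality)
  show "\<exists>S\<in>simplices T. (x, y) \<in> affine_graph \<Phi> S" using S xy by blast
  fix y' assume "\<exists>S\<in>simplices T. (x, y') \<in> affine_graph \<Phi> S"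
  then obtain S' where S': "S' \<in> simplices T" "(x, y') \<in> affine_graph \<Phi> S'" by blast
  \<comment> \<open>With equal first components, the scaling estimate bounds the distance of the
    values by zero.\<close>
  have inj: "b = c" if "R \<in> simplices T" "(x, b) \<in> affine_graph \<Phi> R" "(x, c) \<in> affine_graph \<Phi> R" for R b c
    using simplex_near_scaling[OF T that] by simp
  have x: "x \<in> S" "x \<in> S'" using fst_affine_graph_simplices[OF T] S S' xy by force+
  obtain K where K: "K \<in> simplices T" "x \<in> K" "K \<inter> S face_of S" "K \<inter> S face_of K"
    "K \<inter> S' face_of S'" "K \<inter> S' face_of K"
    using common_simplex[OF T S S'(1) x] by blast
  \<comment> \<open>The value over \<open>R\<close> at \<open>x\<close> is already taken over the
    face \<open>K \<inter> R\<close>, hence also over \<open>K\<close>. So \<open>S\<close> and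
    \<open>S'\<close> both agree with \<open>K\<close> at \<open>x\<close>.\<close>
  have shared: "(x, b) \<in> affine_graph \<Phi> K"
    if h: "R \<in> simplices T" "(x, b) \<in> affine_graph \<Phi> R" "x \<in> R" "K \<inter> R face_of R" "K \<inter> R face_of K" for R b
  proof -
    have "compact (K \<inter> R)" "convex (K \<inter> R)"
      using simplices_convex_compact[OF T h(1)] face_of_imp_compact[OF _ _ h(4)]
        face_of_imp_convex[OF h(4)] by auto
    then have "fst ` affine_graph \<Phi> (K \<inter> R) = K \<inter> R" by (rule fst_affine_graph)
    then obtain c where c: "(x, c) \<in> affine_graph \<Phi> (K \<inter> R)" using h(3) K(2) by force
    then have "(x, c) \<in> affine_graph \<Phi> R" using affine_graph_face[OF h(4)] by blast
    then have "c = b" using inj h(1,2) by blast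
    then show ?thesis using c affine_graph_face[OF h(5)] by blast
  qed
  show "y' = y"
    using inj[OF K(1)] shared[OF S'(1,2) x(2) K(5,6)] shared[OF S xy x(1) K(3,4)] by blast
qed

lemma deform_in_graph:
  assumes "T \<in> P" "S \<in> simplices T" "x \<in> S"
  shows "(x, deform T x) \<in> affine_graph \<Phi> S"
proof -
  obtain y where "(x, y) \<in> affine_graph \<Phi> S"
    using fst_affine_graph_simplices[OF assms(1,2)] assms(3) by force
  then show ?thesis using deform_eqI[OF assms(1,2)] by blast
qed

lemma simplices_cover:
  assumes "T \<in> P"
  obtains t S where "t \<in> T" "S \<in> fst t" "x \<in> S"
proof -
  have "(\<Union>t\<in>T. support t) = UNIV" using assms P_tilings by (auto simp: tilings_def)
  then show ?thesis using that unfolding support_def triangulation_of_def by blast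
qed

lemma simplices_meeting_finite:
  assumes "T \<in> P" "bounded B"
  shows "finite {S \<in> simplices T. S \<inter> B \<noteq> {}}"
proof (rule finite_subset)
  show "{S \<in> simplices T. S \<inter> B \<noteq> {}} \<subseteq> (\<Union>t\<in>patch T B. fst t)"
    by (auto simp: simplices_def patch_def support_def triangulation_of_def)
  have "finite (fst t)" if t: "t \<in> T" for t
  proof -
    obtain p u where "p \<in> Pr" "t = translate_tile u p" using tile_cases[OF assms(1) t] .
    then show ?thesis
      using prototile_complex by (simp add: translate_tile_def simplicial_complex_def)
  qed
  moreover have "finite (patch T B)"
    using finite_patch[OF finite_Pr _ _ assms(2)] prototile assms(1) P_tilings by blast
  ultimately show "finite (\<Union>t\<in>patch T B. fst t)"
    by (intro finite_UN_I) (auto simp: patch_def)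
qed

text \<open>The segment from \<open>y\<close> to \<open>x\<close> crosses finitely many simplices.
  Along it the deviation from scaling by \<open>N\<close> is Lipschitz with the same constant on
  each of the closed pieces, and on an interval such pieces glue without loss.\<close>

lemma deform_near_scaling:
  assumes T: "T \<in> P"
  shows "norm (deform T x - deform T y - N *\<^sub>R (x - y)) \<le> N / 2 * norm (x - y)"
proof -
  define c where "c s = y + s *\<^sub>R (x - y)" for s :: real
  define g where "g s = deform T (c s) - N *\<^sub>R c s" for s
  let ?I = "{S \<in> simplices T. S \<inter> c ` {0..1} \<noteq> {}}" and ?M = "N / 2 * norm (x - y)"
  have cont: "continuous_on A c" for A unfolding c_def by (intro continuous_intros)
  have "bounded (c ` {0..1})"
    by (intro compact_imp_bounded compact_continuous_image cont compact_Icc)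
  then have fin: "finite ?I" using simplices_meeting_finite[OF T] by blast
  have "?M-lipschitz_on {0..1} g"
  proof (rule lipschitz_on_closed_Union[OF _ _ fin])
    show "0 \<le> ?M" using N_pos by simp
    show "{0..1} \<subseteq> (\<Union>S\<in>?I. c -` S)"
    proof
      fix s :: real assume s: "s \<in> {0..1}"
      obtain t S where "t \<in> T" "S \<in> fst t" "c s \<in> S" using simplices_cover[OF T] .
      then show "s \<in> (\<Union>S\<in>?I. c -` S)" using s unfolding simplices_def by blast
    qed
    fix S assume "S \<in> ?I"
    then have S: "S \<in> simplices T" by simp
    show "closed (c -` S)"
      using simplices_convex_compact(2)[OF T S] cont[of UNIV]
      by (intro continuous_closed_vimage) (auto simp: compact_imp_closed continuous_on_eq_continuous_at)
    show "?M-lipschitz_on (c -` S) g"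
    proof (rule lipschitz_onI)
      fix s r assume "s \<in> c -` S" "r \<in> c -` S"
      then have "norm (deform T (c s) - deform T (c r) - N *\<^sub>R (c s - c r)) \<le> N / 2 * norm (c s - c r)"
        using simplex_near_scaling[OF T S] deform_in_graph[OF T S] by simp
      moreover have "norm (c s - c r) = norm (x - y) * dist s r"
        unfolding c_def dist_real_def by (simp add: mult.commute flip: scaleR_left_diff_distrib)
      ultimately show "dist (g s) (g r) \<le> ?M * dist s r"
        unfolding g_def dist_norm by (simp add: algebra_simps)
    qed (use N_pos in simp)
  qed
  then have "dist (g 1) (g 0) \<le> ?M * dist 1 (0::real)"
    by (rule lipschitz_onD) auto
  then show ?thesis unfolding g_def c_def dist_norm by (simp add: algebra_simps)
qed

text \<open>Vertices and deformed points shift by the same \<open>\<Phi> u\<close>, so their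
  relative position is unaffected by the lack of a bound on \<open>\<Phi> u\<close>.\<close>

lemma deform_translate:
  assumes T: "T \<in> P"
  shows "deform (translate_tiling u T) (u + x) = \<Phi> u + deform T x"
proof -
  obtain t S where "t \<in> T" "S \<in> fst t" "x \<in> S" using simplices_cover[OF T] .
  then have S: "S \<in> simplices T" "x \<in> S" by (auto simp: simplices_def)
  show ?thesis
  proof (rule deform_eqI)
    show "translate_tiling u T \<in> P" by (rule P_translate[OF T])
    show "(+) u ` S \<in> simplices (translate_tiling u T)" using S by (simp add: simplices_translate)
    show "(u + x, \<Phi> u + deform T x) \<in> affine_graph \<Phi> ((+) u ` S)"
      using deform_in_graph[OF T S] unfolding affine_graph_translation[OF add]
      by (metis image_eqI add_Pair)
  qed
qed

text \<open>The value at \<open>x\<close> is determined by any one tile that contains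
  \<open>x\<close>.\<close>

lemma deform_local:
  assumes T: "T \<in> P" "T' \<in> P" and eq: "patch T B = patch T' B" and x: "x \<in> B"
  shows "deform T x = deform T' x"
proof -
  obtain t S where t: "t \<in> T" "S \<in> fst t" "x \<in> S" using simplices_cover[OF T(1)] .
  then have "t \<in> patch T B" using x by (auto simp: patch_def support_def triangulation_of_def)
  then have "t \<in> T'" using eq by (auto simp: patch_def)
  then have S: "S \<in> simplices T" "S \<in> simplices T'" using t by (auto simp: simplices_def)
  show ?thesis using deform_eqI[OF T(1) S(1) deform_in_graph[OF T(2) S(2) t(3)]] .
qed

section \<open>All deformed vertices lie in one coset of the lattice\<close>

lemma vertices_lattice_simplex:
  assumes "T \<in> P" "S \<in> simplices T" "v extreme_point_of S" "w extreme_point_of S"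
  shows "\<Phi> v - \<Phi> w \<in> int_lattice"
proof -
  obtain t where "t \<in> T" "S \<in> fst t" using assms(2) by (auto simp: simplices_def)
  then obtain p u S0 where p: "p \<in> Pr" "S0 \<in> fst p" "S = (+) u ` S0"
    using simplices_cases[OF assms(1)] by metis
  then obtain v0 w0 where "v = u + v0" "v0 extreme_point_of S0" "w = u + w0" "w0 extreme_point_of S0"
    using assms(3,4) extreme_points_of_translation[of u S0] by blast
  then show ?thesis using lattice[OF p(1,2)] by (simp add: add)
qed

lemma simplices_vertex:
  assumes "T \<in> P" "S \<in> simplices T" "S \<noteq> {}"
  obtains v where "v extreme_point_of S"
  using Krein_Milman_Minkowski[of S] simplices_convex_compact[OF assms(1,2)] assms(3)
  by (metis Collect_empty_eq convex_hull_eq_empty)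

text \<open>The mediating simplex \<open>K\<close> meets \<open>S\<close> and \<open>S'\<close> in
  nonempty faces, so it shares a vertex \<open>k\<close> with \<open>S\<close> and a vertex
  \<open>k'\<close> with \<open>S'\<close>. The difference is then a sum of three differences, each
  within one simplex.\<close>

lemma intersecting_simplices_lattice:
  assumes T: "T \<in> P" and S: "S \<in> simplices T" "S' \<in> simplices T" and x: "x \<in> S" "x \<in> S'"
    and v: "v extreme_point_of S" "w extreme_point_of S'"
  shows "\<Phi> v - \<Phi> w \<in> int_lattice"
proof -
  obtain K where K: "K \<in> simplices T" "x \<in> K" "K \<inter> S face_of S" "K \<inter> S face_of K"
    "K \<inter> S' face_of S'" "K \<inter> S' face_of K"
    using common_simplex[OF T S x] by blast
  have shared: "\<exists>k. k extreme_point_of R \<and> k extreme_point_of K"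
    if h: "R \<in> simplices T" "x \<in> R" "K \<inter> R face_of R" "K \<inter> R face_of K" for R
  proof -
    have "compact (K \<inter> R)" "convex (K \<inter> R)" "K \<inter> R \<noteq> {}"
      using face_of_imp_compact face_of_imp_convex h K(2)
        simplices_convex_compact[OF T h(1)] by blast+
    then obtain k where "k extreme_point_of (K \<inter> R)"
      using Krein_Milman_Minkowski[of "K \<inter> R"] by (metis Collect_empty_eq convex_hull_eq_empty)
    then show ?thesis using extreme_point_of_face h(3,4) by blast
  qed
  obtain k k' where "k extreme_point_of S" "k extreme_point_of K"
    "k' extreme_point_of S'" "k' extreme_point_of K"
    using shared[OF S(1) x(1) K(3,4)] shared[OF S(2) x(2) K(5,6)] by blast
  then have "\<Phi> v - \<Phi> k \<in> int_lattice" "\<Phi> k - \<Phi> k' \<in> int_lattice" "\<Phi> k' - \<Phi> w \<in> int_lattice"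
    using vertices_lattice_simplex[OF T] S K(1) v by blast+
  then have "(\<Phi> v - \<Phi> k) + (\<Phi> k - \<Phi> k') + (\<Phi> k' - \<Phi> w) \<in> int_lattice"
    by (intro int_lattice_add)
  then show ?thesis by simp
qed

text \<open>Connectedness of the segment from \<open>v\<close> to \<open>w\<close> replaces an
  explicit chain of simplices. The simplices meeting it split into those with a vertex congruent to
  \<open>v\<close> and the rest; the two unions are closed, cover the segment, and are disjoint
  because intersecting simplices have congruent vertices.\<close>

lemma vertices_lattice:
  assumes T: "T \<in> P" and v: "v \<in> vertices T" and w: "w \<in> vertices T"
  shows "\<Phi> v - \<Phi> w \<in> int_lattice"
proof (rule ccontr)
  assume neg: "\<Phi> v - \<Phi> w \<notin> int_lattice"
  let ?L = "closed_segment v w"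
  let ?I = "{S \<in> simplices T. S \<inter> ?L \<noteq> {}}"
  let ?A = "{S \<in> ?I. \<exists>a. a extreme_point_of S \<and> \<Phi> v - \<Phi> a \<in> int_lattice}"
  let ?B = "{S \<in> ?I. \<not> (\<exists>a. a extreme_point_of S \<and> \<Phi> v - \<Phi> a \<in> int_lattice)}"
  have fin: "finite ?I" using simplices_meeting_finite[OF T bounded_closed_segment] .
  obtain S S' where S: "S \<in> simplices T" "v extreme_point_of S" "S' \<in> simplices T" "w extreme_point_of S'"
    using v w by (auto simp: vertices_def)
  then have vS: "v \<in> S" "w \<in> S'" by (auto simp: extreme_point_of_def)
  have fin': "finite ?A" "finite ?B" by (rule finite_subset[OF _ fin]; blast)+
  have cl: "closed R" if "R \<in> simplices T" for R
    using simplices_convex_compact(2)[OF T that] compact_imp_closed by blast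
  have A: "closed (\<Union>?A)" by (rule closed_Union[OF fin'(1)]) (simp add: cl)
  have B: "closed (\<Union>?B)" by (rule closed_Union[OF fin'(2)]) (simp add: cl)
  have cover: "?L \<subseteq> \<Union>?A \<union> \<Union>?B"
  proof
    fix x assume x: "x \<in> ?L"
    obtain t R where "t \<in> T" "R \<in> fst t" "x \<in> R" using simplices_cover[OF T] .
    then have "R \<in> ?I" "x \<in> R" using x unfolding simplices_def by blast+
    then show "x \<in> \<Union>?A \<union> \<Union>?B" by blast
  qed
  have disj: "x \<notin> \<Union>?B" if x: "x \<in> \<Union>?A" for x
  proof
    assume "x \<in> \<Union>?B"
    then obtain R' where R': "R' \<in> simplices T" "x \<in> R'"
      "\<And>b. b extreme_point_of R' \<Longrightarrow> \<Phi> v - \<Phi> b \<notin> int_lattice" by blast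
    obtain R a where R: "R \<in> simplices T" "x \<in> R" "a extreme_point_of R" "\<Phi> v - \<Phi> a \<in> int_lattice"
      using x by blast
    obtain b where b: "b extreme_point_of R'" using simplices_vertex[OF T R'(1)] R'(2) by blast
    then have "\<Phi> a - \<Phi> b \<in> int_lattice"
      using intersecting_simplices_lattice[OF T R(1) R'(1) R(2) R'(2) R(3)] by blast
    then have "\<Phi> v - \<Phi> b \<in> int_lattice" using int_lattice_add[OF R(4)] by fastforce
    then show False using R'(3) b by blast
  qed
  have "S \<in> ?A" using S vS by (auto intro!: exI[of _ v])
  then have "\<Union>?A \<inter> ?L \<noteq> {}" using vS by auto
  moreover have "\<Phi> v - \<Phi> a \<notin> int_lattice" if "a extreme_point_of S'" for a
  proof
    assume "\<Phi> v - \<Phi> a \<in> int_lattice"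
    moreover have "\<Phi> a - \<Phi> w \<in> int_lattice" using vertices_lattice_simplex[OF T S(3) that S(4)] .
    ultimately have "\<Phi> v - \<Phi> w \<in> int_lattice" using int_lattice_add by fastforce
    then show False using neg by blast
  qed
  then have "S' \<in> ?B" using S vS by auto
  then have "\<Union>?B \<inter> ?L \<noteq> {}" using vS by auto
  moreover have "\<Union>?A \<inter> \<Union>?B \<inter> ?L = {}" using disj by blast
  ultimately show False
    using connected_closed[of ?L] connected_segment A B cover by blast
qed

end


subsection \<open>The phase of a tiling and the deformed translation flow\<close>

lemma torus_proj_eq_iff: "torus_proj x = torus_proj y \<longleftrightarrow> x - y \<in> int_lattice"
proof
  assume eq: "torus_proj x = torus_proj y"
  have "x \<in> torus_proj x" unfolding torus_proj_def by (auto intro!: exI[of _ 0])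
  then show "x - y \<in> int_lattice" unfolding eq by (auto simp: torus_proj_def int_lattice_def)
next
  have "torus_proj a \<subseteq> torus_proj b" if "a - b \<in> int_lattice" for a b :: "real ^ 'a"
  proof
    fix c assume "c \<in> torus_proj a"
    then obtain z where "c = a + z" "z \<in> int_lattice" by (auto simp: torus_proj_def int_lattice_def)
    then have "c = b + (a - b + z)" "a - b + z \<in> int_lattice" using that int_lattice_add by auto
    then show "c \<in> torus_proj b" unfolding torus_proj_def int_lattice_def by blast
  qed
  moreover assume "x - y \<in> int_lattice"
  ultimately show "torus_proj x = torus_proj y" using int_lattice_minus by blast
qed

text \<open>The preimage of the image is the union of the lattice translates of
  \<open>U\<close>.\<close>

lemma openin_torus_proj_image:
  assumes "open U"
  shows "openin torus (torus_proj ` U)"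
proof -
  have "torus_proj -` (torus_proj ` U) = (\<Union>z\<in>int_lattice. (+) z ` U)"
  proof (intro equalityI subsetI)
    fix x assume "x \<in> torus_proj -` (torus_proj ` U)"
    then obtain y where y: "y \<in> U" "x - y \<in> int_lattice" by (auto simp: torus_proj_eq_iff)
    then have "x \<in> (+) (x - y) ` U" by (intro image_eqI[of _ _ y]) auto
    then show "x \<in> (\<Union>z\<in>int_lattice. (+) z ` U)" using y(2) by blast
  next
    fix x assume "x \<in> (\<Union>z\<in>int_lattice. (+) z ` U)"
    then obtain z y where "z \<in> int_lattice" "y \<in> U" "x = z + y" by blast
    then have "torus_proj x = torus_proj y" by (simp add: torus_proj_eq_iff)
    then show "x \<in> torus_proj -` (torus_proj ` U)" using \<open>y \<in> U\<close> by auto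
  qed
  moreover have "open (\<Union>z\<in>int_lattice. (+) z ` U)" using assms by (auto intro: open_translation)
  ultimately show ?thesis by (auto simp: openin_torus)
qed

lemma closed_int_lattice: "closed (int_lattice :: (real ^ 'n::finite) set)"
proof -
  have eq: "(int_lattice :: (real ^ 'n) set) = (\<Inter>i. (\<lambda>z. z $ i) -` \<int>)"
    by (auto simp: int_lattice_def)
  have "closed ((\<lambda>z::real ^ 'n. z $ i) -` \<int>)" for i
    by (intro continuous_closed_vimage closed_Ints) simp
  then show ?thesis unfolding eq by (intro closed_INT ballI)
qed

text \<open>Needed for the fiber over zero to be closed in the space of tilings.\<close>

lemma closedin_torus_zero: "closedin torus {torus_proj (0 :: real ^ 'n::finite)}"
proof -
  let ?U = "range torus_proj - {torus_proj (0 :: real ^ 'n)}"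
  have "torus_proj x = torus_proj 0 \<longleftrightarrow> x \<in> int_lattice" for x :: "real ^ 'n"
    using torus_proj_eq_iff[of x 0] by simp
  then have eq: "torus_proj -` ?U = - int_lattice"
    by (intro set_eqI) (simp only: vimage_eq Diff_iff rangeI singleton_iff Compl_iff simp_thms)
  have "openin torus ?U"
    unfolding openin_torus eq using closed_int_lattice[unfolded closed_def] by simp
  moreover have "{torus_proj (0 :: real ^ 'n)} \<subseteq> range torus_proj"
    by (simp only: insert_subset rangeI empty_subsetI simp_thms)
  ultimately show ?thesis unfolding closedin_def topspace_torus by simp
qed

text \<open>\<open>tiling_close\<close> ties the size of the shifts to the inverse of the radius, so
  a single parameter must be small against \<open>a\<close> while its inverse is large against
  \<open>K\<close>.\<close>

lemma small_scale_exists: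
  fixes a K :: real
  assumes "0 < a"
  obtains \<delta> where "0 < \<delta>" "\<delta> < a" "\<delta> \<le> 1" "K \<le> 1 / \<delta>"
proof
  let ?d = "min (a / 2) (1 / (1 + \<bar>K\<bar>))"
  show pos: "0 < ?d" using assms by simp
  show "?d < a" using assms by linarith
  have "1 / (1 + \<bar>K\<bar>) \<le> 1" by (simp add: divide_le_eq)
  then show "?d \<le> 1" by linarith
  have "1 / (1 / (1 + \<bar>K\<bar>)) \<le> 1 / ?d"
    using pos by (intro divide_left_mono) auto
  then show "K \<le> 1 / ?d" by simp
qed

text \<open>Neighbourhoods given by \<open>tiling_close\<close> are not known to be open, so this
  relative criterion is not automatic. For closed \<open>Q\<close> the set \<open>W\<close> together
  with the complement of \<open>Q\<close> is open in the full space and cuts out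
  \<open>W\<close>.\<close>

lemma openin_closed_subspace_tiling_topology:
  assumes "closedin (tiling_topology Pr) Q"
  shows "openin (subtopology (tiling_topology Pr) Q) W \<longleftrightarrow>
    W \<subseteq> Q \<and> (\<forall>T\<in>W. \<exists>\<epsilon>>0. \<forall>T'\<in>Q. tiling_close \<epsilon> T T' \<longrightarrow> T' \<in> W)" (is "_ \<longleftrightarrow> ?rhs")
proof
  have Q: "Q \<subseteq> tilings Pr"
    using closedin_subset[OF assms] by (simp add: topspace_tiling_topology)
  have co: "openin (tiling_topology Pr) (tilings Pr - Q)"
    using assms by (simp add: closedin_def topspace_tiling_topology)
  {
    assume "openin (subtopology (tiling_topology Pr) Q) W"
    then obtain U where "openin (tiling_topology Pr) U" "W = U \<inter> Q"
      by (auto simp: openin_subtopology)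
    then show ?rhs unfolding openin_tiling_topology using Q by blast
  }
  assume rhs: ?rhs
  have "openin (tiling_topology Pr) (W \<union> (tilings Pr - Q))"
    unfolding openin_tiling_topology
  proof (intro conjI ballI)
    show "W \<union> (tilings Pr - Q) \<subseteq> tilings Pr" using rhs Q by blast
    fix T assume T: "T \<in> W \<union> (tilings Pr - Q)"
    show "\<exists>\<epsilon>>0. \<forall>T'\<in>tilings Pr. tiling_close \<epsilon> T T' \<longrightarrow> T' \<in> W \<union> (tilings Pr - Q)"
    proof (cases "T \<in> W")
      case True
      then show ?thesis using rhs by blast
    next
      case False
      then show ?thesis using T co unfolding openin_tiling_topology by blast
    qed
  qed
  moreover have "W = (W \<union> (tilings Pr - Q)) \<inter> Q" using rhs by blast
  ultimately show "openin (subtopology (tiling_topology Pr) Q) W"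
    unfolding openin_subtopology by blast
qed

context lattice_deformation
begin

section \<open>Inverting the deformation; the reparametrised flow\<close>

lemma deform_expansion:
  assumes T: "T \<in> P"
  shows "norm (deform T x - deform T y) \<le> 3 / 2 * N * norm (x - y)"
    and "N / 2 * norm (x - y) \<le> norm (deform T x - deform T y)"
proof -
  let ?d = "deform T x - deform T y"
  have near: "norm (?d - N *\<^sub>R (x - y)) \<le> N / 2 * norm (x - y)" by (rule deform_near_scaling[OF T])
  have scale: "norm (N *\<^sub>R (x - y)) = N * norm (x - y)" using N_pos by simp
  show "norm ?d \<le> 3 / 2 * N * norm (x - y)"
    using norm_triangle_sub[of ?d "N *\<^sub>R (x - y)"] near scale by (simp add: algebra_simps)
  show "N / 2 * norm (x - y) \<le> norm ?d"
    using norm_triangle_sub[of "N *\<^sub>R (x - y)" ?d] near scale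
    by (simp add: algebra_simps norm_minus_commute)
qed

text \<open>One step of the Newton-like iteration \<open>h\<close>, with \<open>N\<close> in place
  of the derivative, contracts distances by one half; its fixed points are the solutions. Existence
  and uniqueness come together.\<close>

lemma displacement_bij:
  assumes T: "T \<in> P"
  shows "\<exists>!x. deform T x - deform T 0 = w"
proof -
  define h where "h x = x - (1 / N) *\<^sub>R (deform T x - deform T 0 - w)" for x
  have "dist (h x) (h y) \<le> 1 / 2 * dist x y" for x y
  proof -
    have "h x - h y = (- 1 / N) *\<^sub>R (deform T x - deform T y - N *\<^sub>R (x - y))"
      using N_pos by (simp add: h_def algebra_simps)
    then have "dist (h x) (h y) = (1 / N) * norm (deform T x - deform T y - N *\<^sub>R (x - y))"
      using N_pos by (simp add: dist_norm)
    also have "\<dots> \<le> (1 / N) * (N / 2 * norm (x - y))"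
      using N_pos deform_near_scaling[OF T] by (intro mult_left_mono) auto
    finally show ?thesis using N_pos by (simp add: dist_norm)
  qed
  then have "\<exists>!x. h x = x" by (intro banach_fix_type[of "1 / 2"]) auto
  moreover have "h x = x \<longleftrightarrow> deform T x - deform T 0 = w" for x
    using N_pos by (simp add: h_def)
  ultimately show ?thesis by simp
qed

definition locate :: "('n, 'm) tiling \<Rightarrow> real ^ 'n \<Rightarrow> real ^ 'n" where
  "locate T w = (THE x. deform T x - deform T 0 = w)"

lemma deform_locate: "T \<in> P \<Longrightarrow> deform T (locate T w) - deform T 0 = w"
  unfolding locate_def using theI'[OF displacement_bij] by blast

lemma locate_eqI: "T \<in> P \<Longrightarrow> deform T x - deform T 0 = w \<Longrightarrow> locate T w = x"
  using deform_locate displacement_bij by blast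

lemma norm_locate_diff:
  assumes T: "T \<in> P"
  shows "norm (locate T w - locate T w') \<le> 2 / N * norm (w - w')"
proof -
  have "deform T (locate T w) - deform T (locate T w') = w - w'"
    using deform_locate[OF T, of w] deform_locate[OF T, of w'] by (simp add: algebra_simps)
  then have "N / 2 * norm (locate T w - locate T w') \<le> norm (w - w')"
    using deform_expansion(2)[OF T] by metis
  then show ?thesis using N_pos by (simp add: field_simps)
qed

lemma locate_0: "T \<in> P \<Longrightarrow> locate T 0 = 0"
  by (rule locate_eqI) auto

lemma norm_locate: "T \<in> P \<Longrightarrow> norm (locate T w) \<le> 2 / N * norm w"
  using norm_locate_diff[of T w 0] by (simp add: locate_0)

text \<open>The minus sign brings to the origin the point whose deformed displacement from the
  origin is \<open>w\<close>.\<close>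

definition flow :: "('n, 'm) tiling \<Rightarrow> real ^ 'n \<Rightarrow> ('n, 'm) tiling" where
  "flow T w = translate_tiling (- locate T w) T"

lemma flow_in: "T \<in> P \<Longrightarrow> flow T w \<in> P"
  unfolding flow_def by (rule P_translate)

lemma flow_0: "T \<in> P \<Longrightarrow> flow T 0 = T"
  by (simp add: flow_def locate_0)

lemma translate_eq_flow:
  "T \<in> P \<Longrightarrow> translate_tiling (- x) T = flow T (deform T x - deform T 0)"
  unfolding flow_def using locate_eqI by simp

lemma deform_translate_minus:
  assumes "T \<in> P"
  shows "deform (translate_tiling (- x) T) y = deform T (x + y) - \<Phi> x"
  using deform_translate[OF assms, of "- x" "x + y"] diff[of 0 x] by (simp add: zero)

text \<open>Displacements in the deformed space add up, and the shift of \<open>deform\<close> by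
  \<open>\<Phi>\<close> of the translation vector cancels in differences.\<close>

lemma flow_flow:
  assumes T: "T \<in> P"
  shows "flow (flow T a) b = flow T (a + b)"
proof -
  let ?x = "locate T a" and ?z = "locate T (a + b)"
  have "locate (flow T a) b = ?z - ?x"
  proof (rule locate_eqI[OF flow_in[OF T]])
    have "deform T ?z - deform T ?x = b"
      using deform_locate[OF T, of a] deform_locate[OF T, of "a + b"] by (simp add: algebra_simps)
    then show "deform (flow T a) (?z - ?x) - deform (flow T a) 0 = b"
      unfolding flow_def by (simp add: deform_translate_minus[OF T])
  qed
  then show ?thesis by (simp add: flow_def translate_tiling_translate)
qed

text \<open>Another choice of vertex changes the argument by a lattice vector, by
  \<open>vertices_lattice\<close>.\<close>

definition phase :: "('n, 'm) tiling \<Rightarrow> (real ^ 'n) set" where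
  "phase T = torus_proj (deform T 0 - \<Phi> (SOME v. v \<in> vertices T))"

lemma phase_eq:
  assumes T: "T \<in> P" and v: "v \<in> vertices T"
  shows "phase T = torus_proj (deform T 0 - \<Phi> v)"
  unfolding phase_def torus_proj_eq_iff
  using vertices_lattice[OF T v someI[of "\<lambda>v. v \<in> vertices T", OF v]] by simp

lemma vertices_near:
  assumes "T \<in> P"
  obtains t v S where "t \<in> T" "S \<in> fst t" "x \<in> S" "v extreme_point_of S" "v \<in> vertices T"
proof -
  obtain t S where t: "t \<in> T" "S \<in> fst t" "x \<in> S" using simplices_cover[OF assms] .
  then have S: "S \<in> simplices T" "S \<noteq> {}" by (auto simp: simplices_def)
  then obtain v where "v extreme_point_of S" using simplices_vertex[OF assms] by blast
  moreover from this have "v \<in> vertices T" using S(1) unfolding vertices_def by blast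
  ultimately show ?thesis using that t by blast
qed

text \<open>A tile containing the origin is shared, and it supplies both the deformed origin and a
  reference vertex.\<close>

lemma phase_local:
  assumes T: "T \<in> P" "T' \<in> P" and eq: "patch T (cball 0 R) = patch T' (cball 0 R)" and "0 \<le> R"
  shows "phase T = phase T'"
proof -
  obtain t v S where t: "t \<in> T" "S \<in> fst t" "0 \<in> S" "v extreme_point_of S" "v \<in> vertices T"
    using vertices_near[OF T(1)] .
  have "0 \<in> support t" using t(2,3) by (auto simp: support_def triangulation_of_def)
  then have "t \<in> patch T (cball 0 R)" using t(1) \<open>0 \<le> R\<close> by (auto simp: patch_def)
  then have "t \<in> T'" unfolding eq by (simp add: patch_def)
  then have "v \<in> vertices T'" using t(2,4) by (auto simp: vertices_def simplices_def)
  moreover have "deform T 0 = deform T' 0"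
    using deform_local[OF T eq] \<open>0 \<le> R\<close> by simp
  ultimately show ?thesis using phase_eq[OF T(1) t(5)] phase_eq[OF T(2)] by simp
qed

lemma phase_in_range: "phase T \<in> range torus_proj"
  by (simp add: phase_def)

text \<open>The flow covers the rotation: moving to \<open>?x\<close> changes the deformed origin by
  exactly \<open>w\<close> relative to the deformed vertices, the terms \<open>\<Phi> ?x\<close>
  cancelling.\<close>

lemma phase_flow:
  assumes T: "T \<in> P" and y: "phase T = torus_proj y"
  shows "phase (flow T w) = torus_proj (y + w)"
proof -
  let ?x = "locate T w"
  obtain v where v: "v \<in> vertices T" using vertices_near[OF T] by metis
  have "- ?x + v \<in> vertices (flow T w)" using v by (simp add: flow_def vertices_translate)
  then have "phase (flow T w) = torus_proj (deform (flow T w) 0 - \<Phi> (- ?x + v))"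
    by (rule phase_eq[OF flow_in[OF T]])
  also have "deform (flow T w) 0 - \<Phi> (- ?x + v) = (deform T 0 - \<Phi> v) + w"
    using deform_locate[OF T, of w] diff[of v ?x]
    by (simp add: flow_def deform_translate_minus[OF T] algebra_simps)
  also have "torus_proj \<dots> = torus_proj (y + w)"
  proof -
    have "torus_proj (deform T 0 - \<Phi> v) = torus_proj y" using phase_eq[OF T v] y by simp
    then show ?thesis unfolding torus_proj_eq_iff by simp
  qed
  finally show ?thesis .
qed

lemma locate_local:
  assumes T: "T \<in> P" "T' \<in> P" and eq: "patch T (cball 0 R) = patch T' (cball 0 R)"
    and w: "2 / N * norm w \<le> R"
  shows "locate T w = locate T' w"
proof -
  have "norm (locate T w) \<le> R" using norm_locate[OF T(1), of w] w by linarith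
  then have "deform T (locate T w) = deform T' (locate T w)" "deform T 0 = deform T' 0"
    using deform_local[OF T eq, of "locate T w"] deform_local[OF T eq, of 0] norm_ge_zero[of "locate T w"]
    by (auto simp del: norm_ge_zero)
  then have "deform T' (locate T w) - deform T' 0 = w" using deform_locate[OF T(1), of w] by simp
  then show ?thesis by (rule locate_eqI[OF T(2), symmetric])
qed

lemma flow_local:
  assumes T: "T \<in> P" "T' \<in> P" and eq: "patch T (cball 0 R) = patch T' (cball 0 R)"
    and "2 / N * norm w + r \<le> R" "0 \<le> r"
  shows "patch (flow T w) (cball 0 r) = patch (flow T' w) (cball 0 r)"
proof -
  have "locate T w = locate T' w" using assms by (intro locate_local[OF T eq]) linarith
  moreover have "norm (- locate T w) + r \<le> R" using norm_locate[OF T(1), of w] assms by simp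
  ultimately show ?thesis unfolding flow_def using patch_cball_translate[OF eq] by metis
qed

text \<open>The small translations hidden in \<open>tiling_close\<close> become flow times. The
  factor \<open>3 / 2 * N\<close> is the upper Lipschitz constant of \<open>deform\<close>.\<close>

lemma tiling_close_flow:
  assumes T: "T \<in> P" "T' \<in> P" and close: "tiling_close \<delta> T T'" and "0 < \<delta>"
  obtains T1 T1' a a' where "T1 \<in> P" "T1' \<in> P" "T = flow T1 a" "T' = flow T1' a'"
    "norm a \<le> 3 / 2 * N * \<delta>" "norm a' \<le> 3 / 2 * N * \<delta>"
    "patch T1 (cball 0 (1 / \<delta>)) = patch T1' (cball 0 (1 / \<delta>))"
proof -
  obtain u u' where u: "norm u \<le> \<delta>" "norm u' \<le> \<delta>"
    "patch (translate_tiling u T) (cball 0 (1 / \<delta>)) = patch (translate_tiling u' T') (cball 0 (1 / \<delta>))"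
    using close unfolding tiling_close_def by blast
  have shift: "\<exists>a. X = flow (translate_tiling z X) a \<and> norm a \<le> 3 / 2 * N * \<delta>"
    if X: "X \<in> P" "norm z \<le> \<delta>" for X z
  proof (intro exI conjI)
    let ?X = "translate_tiling z X"
    have X': "?X \<in> P" using P_translate X by blast
    show "X = flow ?X (deform ?X z - deform ?X 0)"
      using translate_eq_flow[OF X', of z] by (simp add: translate_tiling_translate)
    have "norm (deform ?X z - deform ?X 0) \<le> 3 / 2 * N * norm z"
      using deform_expansion(1)[OF X', of z 0] by simp
    also have "\<dots> \<le> 3 / 2 * N * \<delta>" using N_pos X(2) by (intro mult_left_mono) auto
    finally show "norm (deform ?X z - deform ?X 0) \<le> 3 / 2 * N * \<delta>" .
  qed
  show ?thesis
    using shift[OF T(1) u(1)] shift[OF T(2) u(2)] that[OF P_translate[OF T(1)] P_translate[OF T(2)]] u(3)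
    by blast
qed

lemma phase_close:
  assumes T: "T \<in> P" "T' \<in> P" and close: "tiling_close \<delta> T T'" and "0 < \<delta>"
    and y: "phase T = torus_proj y"
  obtains y' where "phase T' = torus_proj y'" "norm (y - y') \<le> 3 * N * \<delta>"
proof -
  obtain T1 T1' a a' where c: "T1 \<in> P" "T1' \<in> P" "T = flow T1 a" "T' = flow T1' a'"
    "norm a \<le> 3 / 2 * N * \<delta>" "norm a' \<le> 3 / 2 * N * \<delta>"
    "patch T1 (cball 0 (1 / \<delta>)) = patch T1' (cball 0 (1 / \<delta>))"
    using tiling_close_flow[OF T close \<open>0 < \<delta>\<close>] .
  have "T1 = flow T (- a)" using flow_flow[OF c(1), of a "- a"] flow_0[OF c(1)] c(3) by simp
  then have "phase T1 = torus_proj (y + - a)" using phase_flow[OF T(1) y] by simp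
  moreover have "phase T1 = phase T1'" using phase_local[OF c(1,2,7)] \<open>0 < \<delta>\<close> by simp
  ultimately have "phase T' = torus_proj (y + - a + a')" using phase_flow[OF c(2)] c(4) by simp
  moreover have "norm (y - (y + - a + a')) \<le> 3 * N * \<delta>"
    using norm_triangle_ineq4[of a a'] c(5,6) by simp
  ultimately show ?thesis using that by blast
qed

text \<open>Close tilings become equal on a large ball once the flow has brought them to the same
  phase: the small translations allowed by the topology move the phase by less than a lattice
  vector, so they have to cancel.\<close>

lemma flow_to_fiber_agree:
  assumes T: "T \<in> P" "T' \<in> P" and close: "tiling_close \<delta> T T'" and \<delta>: "0 < \<delta>" "3 * N * \<delta> < 1 / 2"
    and y: "phase T = torus_proj y" "phase T' = torus_proj y'" "norm (y - y') \<le> 1 / 2"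
    and R: "0 \<le> R" "2 / N * norm y + 3 * \<delta> + R \<le> 1 / \<delta>"
  shows "patch (flow T (- y)) (cball 0 R) = patch (flow T' (- y')) (cball 0 R)"
proof -
  obtain T1 T1' a a' where c: "T1 \<in> P" "T1' \<in> P" "T = flow T1 a" "T' = flow T1' a'"
    "norm a \<le> 3 / 2 * N * \<delta>" "norm a' \<le> 3 / 2 * N * \<delta>"
    "patch T1 (cball 0 (1 / \<delta>)) = patch T1' (cball 0 (1 / \<delta>))"
    using tiling_close_flow[OF T close \<delta>(1)] .
  obtain z where z: "phase T1 = torus_proj z" using phase_in_range by blast
  have "phase T1 = phase T1'" using phase_local[OF c(1,2,7)] \<delta>(1) by simp
  then have z': "phase T1' = torus_proj z" using z by simp
  have "torus_proj (z + a) = torus_proj y" "torus_proj (z + a') = torus_proj y'"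
    using phase_flow[OF c(1) z, of a] phase_flow[OF c(2) z', of a'] c(3,4) y by simp_all
  then have "(z + a - y) - (z + a' - y') \<in> int_lattice"
    unfolding torus_proj_eq_iff by (rule int_lattice_diff)
  \<comment> \<open>The shifts \<open>a\<close> and \<open>a'\<close> contribute less than 1/2
    together and \<open>y - y'\<close> at most 1/2, which stays below the shortest nonzero lattice
    vector.\<close>
  moreover have "norm ((z + a - y) - (z + a' - y')) < 1"
  proof -
    have "norm ((z + a - y) - (z + a' - y')) = norm ((a - a') - (y - y'))"
      by (rule arg_cong[of _ _ norm]) simp
    also have "\<dots> \<le> norm a + norm a' + norm (y - y')"
      using norm_triangle_ineq4[of "a - a'" "y - y'"] norm_triangle_ineq4[of a a'] by linarith
    also have "\<dots> < 1" using c(5,6) \<delta> y(3) by linarith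
    finally show ?thesis .
  qed
  ultimately have "(z + a - y) - (z + a' - y') = 0" by (rule int_lattice_eq_0)
  \<comment> \<open>Bringing \<open>T\<close> and \<open>T'\<close> to the fiber thus means running
    \<open>T1\<close> and \<open>T1'\<close> for the same time, and \<open>flow_local\<close> keeps
    their agreement on a smaller ball.\<close>
  then have w: "a' + - y' = a + - y" by (simp add: algebra_simps)
  have "2 / N * norm (a + - y) \<le> 2 / N * (3 / 2 * N * \<delta> + norm y)"
    using N_pos norm_triangle_ineq4[of a y] c(5) by (intro mult_left_mono) auto
  also have "\<dots> = 2 / N * norm y + 3 * \<delta>" using N_pos by (simp add: algebra_simps)
  finally have "2 / N * norm (a + - y) + R \<le> 1 / \<delta>" using R by linarith
  then have "patch (flow T1 (a + - y)) (cball 0 R) = patch (flow T1' (a + - y)) (cball 0 R)"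
    by (rule flow_local[OF c(1,2,7) _ R(1)])
  then show ?thesis using c(3,4) flow_flow c(1,2) w by metis
qed

lemma patch_eq_imp_tiling_close:
  assumes "patch T (cball 0 (1 / \<epsilon>)) = patch T' (cball 0 (1 / \<epsilon>))" "0 < \<epsilon>"
  shows "tiling_close \<epsilon> T T'"
  unfolding tiling_close_def using assms by (intro exI[of _ 0]) auto

lemma flow_close:
  assumes T: "T \<in> P" "T' \<in> P" and eq: "patch T (cball 0 R) = patch T' (cball 0 R)"
    and "0 < \<epsilon>" "2 / N * norm (w - w') \<le> \<epsilon>" "2 / N * norm w' + 1 / \<epsilon> \<le> R"
  shows "tiling_close \<epsilon> (flow T w) (flow T' w')"
  unfolding tiling_close_def
proof (intro exI conjI)
  \<comment> \<open>Translating by \<open>?u\<close> corrects the time from \<open>w\<close> to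
    \<open>w'\<close>; its length is controlled because \<open>locate\<close> is Lipschitz with
    constant \<open>2 / N\<close>.\<close>
  let ?u = "locate T w - locate T w'"
  show "norm ?u \<le> \<epsilon>" using norm_locate_diff[OF T(1), of w w'] assms(5) by linarith
  show "norm 0 \<le> \<epsilon>" using assms by simp
  have "translate_tiling ?u (flow T w) = flow T w'"
    by (simp add: flow_def translate_tiling_translate)
  then show "patch (translate_tiling ?u (flow T w)) (cball 0 (1 / \<epsilon>)) =
      patch (translate_tiling 0 (flow T' w')) (cball 0 (1 / \<epsilon>))"
    using flow_local[OF T eq assms(6)] assms(4) by simp
qed

subsection \<open>The bundle\<close>

abbreviation "\<Omega> \<equiv> subtopology (tiling_topology Pr) P"

lemma topspace_\<Omega>: "topspace \<Omega> = P"
  using P_tilings by (auto simp: topspace_tiling_topology)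

lemma continuous_map_phase: "continuous_map \<Omega> torus phase"
  unfolding continuous_map_def topspace_\<Omega>
proof (intro conjI allI impI)
  show "phase \<in> P \<rightarrow> topspace torus" using phase_in_range by (auto simp: topspace_torus)
  fix U :: "(real ^ 'n) set set" assume "openin torus U"
  then have U: "open (torus_proj -` U)" by (simp add: openin_torus)
  show "openin \<Omega> {T \<in> P. phase T \<in> U}"
    unfolding openin_closed_subspace_tiling_topology[OF P_closed]
  proof (intro conjI ballI)
    fix T assume "T \<in> {T \<in> P. phase T \<in> U}"
    then have T: "T \<in> P" "phase T \<in> U" by auto
    obtain y where y: "phase T = torus_proj y" using phase_in_range by blast
    then have "y \<in> torus_proj -` U" using T(2) by simp
    then obtain e where e: "0 < e" "ball y e \<subseteq> torus_proj -` U"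
      using U unfolding open_contains_ball by blast
    \<comment> \<open>By \<open>phase_close\<close> the phase then moves by at most
      \<open>e / 2\<close>.\<close>
    have pos: "0 < e / (6 * N)" using e(1) N_pos by simp
    have *: "T' \<in> {T \<in> P. phase T \<in> U}" if T': "T' \<in> P" "tiling_close (e / (6 * N)) T T'" for T'
    proof -
      obtain y' where y': "phase T' = torus_proj y'" "norm (y - y') \<le> 3 * N * (e / (6 * N))"
        using phase_close[OF T(1) T' pos y] .
      then have "y' \<in> ball y e" using e(1) N_pos by (simp add: dist_norm)
      then show ?thesis using y'(1) e(2) T' by auto
    qed
    show "\<exists>\<epsilon>>0. \<forall>T'\<in>P. tiling_close \<epsilon> T T' \<longrightarrow> T' \<in> {T \<in> P. phase T \<in> U}"
      using * pos by blast
  qed auto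
qed

section \<open>The fiber over zero and its total disconnectedness\<close>

definition fiber :: "('n, 'm) tiling set" where
  "fiber = {T \<in> P. phase T = torus_proj 0}"

lemma fiber_P: "T \<in> fiber \<Longrightarrow> T \<in> P"
  by (simp add: fiber_def)

lemma closedin_fiber: "closedin (tiling_topology Pr) fiber"
proof -
  have "closedin \<Omega> {T \<in> topspace \<Omega>. phase T \<in> {torus_proj 0}}"
    by (rule closedin_continuous_map_preimage[OF continuous_map_phase closedin_torus_zero])
  then have "closedin \<Omega> fiber" unfolding topspace_\<Omega> by (simp add: fiber_def)
  then show ?thesis using closedin_closed_subtopology[OF P_closed] by blast
qed

abbreviation "\<F> \<equiv> subtopology (tiling_topology Pr) fiber"

lemma topspace_\<F>: "topspace \<F> = fiber"
  using P_tilings by (auto simp: topspace_tiling_topology fiber_def)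

text \<open>The case \<open>y = y' = 0\<close> of \<open>flow_to_fiber_agree\<close>: on the fiber,
  closeness forces literal agreement of patches without any shift.\<close>

lemma fiber_rigid:
  assumes "0 \<le> R"
  obtains \<delta> where "0 < \<delta>" "\<And>T T'. T \<in> fiber \<Longrightarrow> T' \<in> fiber \<Longrightarrow> tiling_close \<delta> T T' \<Longrightarrow>
    patch T (cball 0 R) = patch T' (cball 0 R)"
proof -
  have "0 < 1 / (6 * N)" using N_pos by simp
  then obtain \<delta> where \<delta>: "0 < \<delta>" "\<delta> < 1 / (6 * N)" "\<delta> \<le> 1" "3 + R \<le> 1 / \<delta>"
    by (rule small_scale_exists)
  have "patch T (cball 0 R) = patch T' (cball 0 R)"
    if T: "T \<in> fiber" "T' \<in> fiber" "tiling_close \<delta> T T'" for T T'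
  proof -
    have P: "T \<in> P" "T' \<in> P" "phase T = torus_proj 0" "phase T' = torus_proj 0"
      using T by (auto simp: fiber_def)
    have "3 * N * \<delta> < 1 / 2" using \<delta>(2) N_pos by (simp add: field_simps)
    then have "patch (flow T (- 0)) (cball 0 R) = patch (flow T' (- 0)) (cball 0 R)"
      using \<delta> assms by (intro flow_to_fiber_agree[OF P(1,2) T(3) \<delta>(1) _ P(3,4)]) auto
    then show ?thesis using P flow_0 by simp
  qed
  then show ?thesis using that \<delta>(1) by blast
qed

text \<open>A patch class and its complement in the fiber both satisfy the condition, so patch
  classes are clopen.\<close>

lemma openin_fiber_patch_class:
  assumes "0 \<le> R" "\<And>T T'. T \<in> W \<Longrightarrow> T' \<in> fiber \<Longrightarrow>
      patch T (cball 0 R) = patch T' (cball 0 R) \<Longrightarrow> T' \<in> W"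
    and "W \<subseteq> fiber"
  shows "openin \<F> W"
  unfolding openin_closed_subspace_tiling_topology[OF closedin_fiber]
proof (intro conjI ballI)
  obtain \<delta> where "0 < \<delta>" "\<And>T T'. T \<in> fiber \<Longrightarrow> T' \<in> fiber \<Longrightarrow> tiling_close \<delta> T T' \<Longrightarrow>
    patch T (cball 0 R) = patch T' (cball 0 R)"
    using fiber_rigid[OF assms(1)] by metis
  then show "\<exists>\<epsilon>>0. \<forall>T'\<in>fiber. tiling_close \<epsilon> T T' \<longrightarrow> T' \<in> W" if "T \<in> W" for T
    using that assms(2,3) by blast
qed (rule assms(3))

lemma totally_disconnected_fiber: "totally_disconnected_space \<F>"
  unfolding totally_disconnected_space_def
proof (intro allI impI)
  fix S assume S: "connectedin \<F> S"
  then have Sf: "S \<subseteq> fiber" using connectedin_subset_topspace topspace_\<F> by blast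
  have patch_eq: "patch T (cball 0 R) = patch T' (cball 0 R)"
    if T: "T \<in> S" "T' \<in> S" and R: "0 \<le> R" for T T' R
  proof -
    let ?W = "{X \<in> fiber. patch T (cball 0 R) = patch X (cball 0 R)}"
    have "openin \<F> ?W" "openin \<F> (fiber - ?W)"
      by (rule openin_fiber_patch_class[OF R]; auto)+
    then have "openin \<F> ?W" "closedin \<F> ?W" unfolding closedin_def topspace_\<F> by blast+
    then have "S \<subseteq> ?W \<or> disjnt S ?W" using connectedin_clopen_cases[OF S] by blast
    moreover have "T \<in> S \<inter> ?W" using T Sf by blast
    ultimately show ?thesis using T(2) unfolding disjnt_def by blast
  qed
  \<comment> \<open>Every tile meets some ball about the origin, so agreement of patches for all
    radii forces equality of the tilings.\<close>
  have sub: "T \<subseteq> T'" if T: "T \<in> S" "T' \<in> S" for T T'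
  proof
    fix t assume t: "t \<in> T"
    have TP: "T \<in> P" using T Sf fiber_P by blast
    obtain p u where p: "p \<in> Pr" "t = translate_tile u p" using tile_cases[OF TP t] .
    then obtain c where "c \<in> support p"
      using prototile_support(2)[OF prototile[OF p(1)]] interior_subset by blast
    then have "u + c \<in> support t \<inter> cball 0 (norm (u + c))" using p(2) by (simp add: support_translate)
    then have "t \<in> patch T (cball 0 (norm (u + c)))" using t unfolding patch_def by blast
    then have "t \<in> patch T' (cball 0 (norm (u + c)))" using patch_eq[OF T norm_ge_zero] by blast
    then show "t \<in> T'" by (simp add: patch_def)
  qed
  show "\<exists>a. S \<subseteq> {a}"
  proof (cases "S = {}")
    case False
    then obtain T where "T \<in> S" by blast
    then have "S \<subseteq> {T}" using sub by blast
    then show ?thesis ..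
  qed auto
qed

text \<open>Over a small ball the projection has the section \<open>s\<close>. Flowing back by
  \<open>s\<close> carries each tiling to the fiber over zero, and flowing forward inverts this,
  since the flow is an action that covers rotation.\<close>

lemma phase_bundle: "fiber_bundle \<Omega> torus \<F> phase"
  unfolding fiber_bundle_def
proof (intro conjI ballI continuous_map_phase)
  fix b :: "(real ^ 'n) set" assume "b \<in> topspace torus"
  then obtain c where c: "b = torus_proj c" by (auto simp: topspace_torus)
  \<comment> \<open>Points of a ball of radius 1/4 differ by less than 1/2, hence never by a nonzero
    lattice vector, so lifts to the ball are unique.\<close>
  define U :: "(real ^ 'n) set set" where "U = torus_proj ` ball c (1 / 4)"
  define s where "s q = (SOME y. y \<in> ball c (1 / 4) \<and> torus_proj y = q)" for q
  define h where "h T = (phase T, flow T (- s (phase T)))" for T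
  define g where "g z = flow (snd z) (s (fst z))" for z
  define D where "D = {T \<in> P. phase T \<in> U}"
  have s: "s (torus_proj y) = y" if y: "y \<in> ball c (1 / 4)" for y
  proof -
    let ?z = "s (torus_proj y)"
    have z: "?z \<in> ball c (1 / 4)" "torus_proj ?z = torus_proj y"
      unfolding s_def using someI[of "\<lambda>x. x \<in> ball c (1 / 4) \<and> torus_proj x = torus_proj y" y] y by auto
    have "norm (?z - y) < 1"
      using dist_triangle2[of ?z y c] z(1) y by (simp add: dist_norm norm_minus_commute)
    then show ?thesis using z(2) int_lattice_eq_0 unfolding torus_proj_eq_iff by fastforce
  qed
  have U: "openin torus U" unfolding U_def by (rule openin_torus_proj_image) simp
  have bU: "b \<in> U" unfolding U_def c by (intro imageI) simp
  have topU: "topspace (subtopology torus U) = U" using openin_subset[OF U] by auto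
  have topD: "topspace (subtopology \<Omega> D) = D" 
    using topspace_subtopology[of \<Omega> D] unfolding topspace_\<Omega> D_def by blast
  have D_rep: "\<exists>y. y \<in> ball c (1 / 4) \<and> phase T = torus_proj y" if "T \<in> D" for T
    using that unfolding D_def U_def by blast
  have flow_fiber: "flow T (- y) \<in> fiber" if "T \<in> P" "phase T = torus_proj y" for T y
    using phase_flow[OF that, of "- y"] flow_in[OF that(1)] by (simp add: fiber_def)
  have phase_fiber_flow: "phase (flow T y) = torus_proj y" if "T \<in> fiber" for T y
    using that phase_flow[of T 0 y] by (simp add: fiber_def)
  have h_cont: "continuous_map (subtopology \<Omega> D) (prod_topology (subtopology torus U) \<F>) h"
    unfolding h_def
  proof (intro continuous_map_pairedI)
    show "continuous_map (subtopology \<Omega> D) (subtopology torus U) phase"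
      by (intro continuous_map_into_subtopology continuous_map_from_subtopology continuous_map_phase)
        (auto simp: D_def)
    show "continuous_map (subtopology \<Omega> D) \<F> (\<lambda>T. flow T (- s (phase T)))"
    proof (rule continuous_map_into_subtopology)
      show "(\<lambda>T. flow T (- s (phase T))) \<in> topspace (subtopology \<Omega> D) \<rightarrow> fiber"
        unfolding topD using D_rep s flow_fiber D_def by fastforce
      show "continuous_map (subtopology \<Omega> D) (tiling_topology Pr) (\<lambda>T. flow T (- s (phase T)))"
        unfolding continuous_map_def topD topspace_tiling_topology
      proof (intro conjI allI impI)
        show "(\<lambda>T. flow T (- s (phase T))) \<in> D \<rightarrow> tilings Pr"
          using flow_in P_tilings by (auto simp: D_def)
        fix V assume V: "openin (tiling_topology Pr) V"
        let ?W = "{T \<in> D. flow T (- s (phase T)) \<in> V}"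
        have "openin \<Omega> ?W"
          unfolding openin_closed_subspace_tiling_topology[OF P_closed]
        proof (intro conjI ballI)
          show "?W \<subseteq> P" by (auto simp: D_def)
          fix T assume T: "T \<in> ?W"
          then have TP: "T \<in> P" by (simp add: D_def)
          obtain y where y: "y \<in> ball c (1 / 4)" "phase T = torus_proj y" using D_rep T by blast
          then have "flow T (- y) \<in> V" using T s by simp
          then obtain \<epsilon> where \<epsilon>: "0 < \<epsilon>"
            "\<And>T'. T' \<in> tilings Pr \<Longrightarrow> tiling_close \<epsilon> (flow T (- y)) T' \<Longrightarrow> T' \<in> V"
            using V unfolding openin_tiling_topology by blast
          \<comment> \<open>The phase moves by at most \<open>3 * N * \<delta>\<close>, so this
            bound keeps the lift \<open>y'\<close> in the ball. The summand 3 in the condition on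
            \<open>1 / \<delta>\<close> dominates the \<open>3 * \<delta>\<close> of
            \<open>flow_to_fiber_agree\<close>.\<close>
          have "0 < (1 / 4 - dist c y) / (3 * N)" using y(1) N_pos by simp
          then obtain \<delta> where \<delta>: "0 < \<delta>" "\<delta> < (1 / 4 - dist c y) / (3 * N)" "\<delta> \<le> 1"
            "2 / N * norm y + 3 + 1 / \<epsilon> \<le> 1 / \<delta>"
            by (rule small_scale_exists)
          have \<delta>N: "3 * N * \<delta> < 1 / 4 - dist c y" using \<delta>(2) N_pos by (simp add: field_simps)
          have "T' \<in> ?W" if T': "T' \<in> P" "tiling_close \<delta> T T'" for T'
          proof -
            obtain y' where y': "phase T' = torus_proj y'" "norm (y - y') \<le> 3 * N * \<delta>"
              using phase_close[OF TP T' \<delta>(1) y(2)] .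
            have yb: "y' \<in> ball c (1 / 4)"
              using y'(2) \<delta>N dist_triangle[of c y' y] by (simp add: dist_norm)
            have "3 * N * \<delta> < 1 / 4" using \<delta>N zero_le_dist[of c y] by linarith
            then have "patch (flow T (- y)) (cball 0 (1 / \<epsilon>)) = patch (flow T' (- y')) (cball 0 (1 / \<epsilon>))"
              using y'(2) \<epsilon>(1) \<delta>
              by (intro flow_to_fiber_agree[OF TP T' \<delta>(1) _ y(2) y'(1)]) auto
            then have "flow T' (- y') \<in> V"
              using \<epsilon> patch_eq_imp_tiling_close flow_in[OF T'(1)] P_tilings by blast
            then show ?thesis using T'(1) yb y'(1) s[OF yb] by (auto simp: D_def U_def)
          qed
          then show "\<exists>\<epsilon>>0. \<forall>T'\<in>P. tiling_close \<epsilon> T T' \<longrightarrow> T' \<in> ?W" using \<delta>(1) by blast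
        qed
        then show "openin (subtopology \<Omega> D) ?W"
          unfolding openin_subtopology[of \<Omega> D] by (intro exI[of _ ?W]) auto
      qed
    qed
  qed
  have g_cont: "continuous_map (prod_topology (subtopology torus U) \<F>) (subtopology \<Omega> D) g"
  proof -
    have top: "topspace (prod_topology (subtopology torus U) \<F>) = U \<times> fiber"
      using topU topspace_\<F> by simp
    have "continuous_map (prod_topology (subtopology torus U) \<F>) (tiling_topology Pr) g"
      unfolding continuous_map_def top topspace_tiling_topology
    proof (intro conjI allI impI)
      show "g \<in> U \<times> fiber \<rightarrow> tilings Pr" using flow_in fiber_P P_tilings by (auto simp: g_def)
      fix V assume V: "openin (tiling_topology Pr) V"
      show "openin (prod_topology (subtopology torus U) \<F>) {z \<in> U \<times> fiber. g z \<in> V}"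
        unfolding openin_prod_topology_alt
      proof (intro allI impI)
        fix q T assume "(q, T) \<in> {z \<in> U \<times> fiber. g z \<in> V}"
        then have qT: "q \<in> U" "T \<in> fiber" "flow T (s q) \<in> V" by (auto simp: g_def)
        obtain y where y: "y \<in> ball c (1 / 4)" "q = torus_proj y" using qT(1) by (auto simp: U_def)
        then have "flow T y \<in> V" using qT(3) s by simp
        then obtain \<epsilon> where \<epsilon>: "0 < \<epsilon>"
          "\<And>T'. T' \<in> tilings Pr \<Longrightarrow> tiling_close \<epsilon> (flow T y) T' \<Longrightarrow> T' \<in> V"
          using V unfolding openin_tiling_topology by blast
        \<comment> \<open>The first bound keeps nearby lifts in the ball around \<open>c\<close>;
          the second turns a time difference below \<open>\<eta>\<close> into a translation of
          length at most \<open>\<epsilon>\<close>. The radius \<open>R\<close> leaves room for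
          flowing up to time \<open>norm y + \<eta>\<close> and still comparing on the ball of
          radius \<open>1 / \<epsilon>\<close>.\<close>
        define \<eta> where "\<eta> = min (1 / 4 - dist c y) (N / 2 * \<epsilon>)"
        define R where "R = 2 / N * (norm y + \<eta>) + 1 / \<epsilon>"
        have \<eta>: "0 < \<eta>" "\<eta> \<le> 1 / 4 - dist c y"
          using y(1) N_pos \<epsilon>(1) by (auto simp: \<eta>_def)
        have \<eta>\<epsilon>: "\<eta> \<le> N / 2 * \<epsilon>" unfolding \<eta>_def by (rule min.cobounded2)
        have R: "0 \<le> R" using N_pos \<epsilon>(1) \<eta>(1) by (simp add: R_def)
        let ?A = "torus_proj ` ball y \<eta>"
        let ?B = "{X \<in> fiber. patch T (cball 0 R) = patch X (cball 0 R)}"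
        have sub: "ball y \<eta> \<subseteq> ball c (1 / 4)"
        proof
          fix y' assume "y' \<in> ball y \<eta>"
          then show "y' \<in> ball c (1 / 4)" using \<eta>(2) dist_triangle[of c y' y] by simp
        qed
        have "openin torus ?A" by (rule openin_torus_proj_image) simp
        moreover have AU: "?A \<subseteq> U" unfolding U_def using sub by (rule image_mono)
        ultimately have A: "openin (subtopology torus U) ?A"
          unfolding openin_subtopology[of torus U] by (intro exI[of _ ?A]) auto
        have B: "openin \<F> ?B" by (rule openin_fiber_patch_class[OF R]) auto
        have "?A \<times> ?B \<subseteq> {z \<in> U \<times> fiber. g z \<in> V}"
        proof
          fix z assume "z \<in> ?A \<times> ?B"
          then obtain y' T' where z: "z = (torus_proj y', T')" "y' \<in> ball y \<eta>" "T' \<in> fiber"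
            "patch T (cball 0 R) = patch T' (cball 0 R)" by auto
          have d: "norm (y - y') < \<eta>" using z(2) by (simp add: dist_norm)
          have "2 / N * norm (y - y') \<le> 2 / N * (N / 2 * \<epsilon>)"
            using d \<eta>\<epsilon> N_pos by (intro mult_left_mono) auto
          then have e1: "2 / N * norm (y - y') \<le> \<epsilon>" using N_pos by simp
          have "norm y' \<le> norm y + \<eta>" using d norm_triangle_sub[of y' y] by (simp add: norm_minus_commute)
          then have "2 / N * norm y' \<le> 2 / N * (norm y + \<eta>)" using N_pos by (intro mult_left_mono) auto
          then have e2: "2 / N * norm y' + 1 / \<epsilon> \<le> R" by (simp add: R_def)
          have "tiling_close \<epsilon> (flow T y) (flow T' y')"
            by (rule flow_close[OF fiber_P[OF qT(2)] fiber_P[OF z(3)] z(4) \<epsilon>(1) e1 e2])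
          then have "flow T' y' \<in> V" using \<epsilon>(2) flow_in[OF fiber_P[OF z(3)]] P_tilings by blast
          moreover have "s (torus_proj y') = y'" using s z(2) sub by blast
          ultimately show "z \<in> {z \<in> U \<times> fiber. g z \<in> V}" using z AU by (auto simp: g_def)
        qed
        moreover have "q \<in> ?A" "T \<in> ?B" using y(2) \<eta>(1) qT(2) by auto
        ultimately show "\<exists>A B. openin (subtopology torus U) A \<and> openin \<F> B \<and> q \<in> A \<and> T \<in> B \<and>
            A \<times> B \<subseteq> {z \<in> U \<times> fiber. g z \<in> V}" using A B by blast
      qed
    qed
    moreover have "g z \<in> P \<inter> D" if z: "z \<in> U \<times> fiber" for z
    proof -
      obtain y T where "z = (torus_proj y, T)" "y \<in> ball c (1 / 4)" "T \<in> fiber"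
        using z by (auto simp: U_def)
      then show ?thesis
        using s phase_fiber_flow flow_in fiber_P by (auto simp: g_def D_def U_def)
    qed
    ultimately show ?thesis
      unfolding subtopology_subtopology by (intro continuous_map_into_subtopology) (auto simp: top)
  qed
  have gh: "g (h T) = T" if "T \<in> D" for T
  proof -
    have TP: "T \<in> P" using that by (simp add: D_def)
    show ?thesis using flow_flow[OF TP] flow_0[OF TP] by (simp add: g_def h_def)
  qed
  have hg: "h (g z) = z" if z: "z \<in> U \<times> fiber" for z
  proof -
    obtain y T where yT: "z = (torus_proj y, T)" "y \<in> ball c (1 / 4)" "T \<in> fiber"
      using z by (auto simp: U_def)
    then show ?thesis
      using s[OF yT(2)] phase_fiber_flow[OF yT(3)] flow_flow[OF fiber_P[OF yT(3)]]
        flow_0[OF fiber_P[OF yT(3)]]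
      by (simp add: g_def h_def)
  qed
  have "homeomorphic_maps (subtopology \<Omega> D) (prod_topology (subtopology torus U) \<F>) h g"
    unfolding homeomorphic_maps_def
    using h_cont g_cont gh hg topD topU topspace_\<F> by (simp only: topspace_prod_topology) blast
  then have "homeomorphic_map (subtopology \<Omega> D) (prod_topology (subtopology torus U) \<F>) h"
    using homeomorphic_map_maps by blast
  then show "\<exists>U h. openin torus U \<and> b \<in> U \<and>
      homeomorphic_map (subtopology \<Omega> {T \<in> topspace \<Omega>. phase T \<in> U})
        (prod_topology (subtopology torus U) \<F>) h \<and>
      (\<forall>T\<in>topspace \<Omega>. phase T \<in> U \<longrightarrow> fst (h T) = phase T)"
    using U bU unfolding topspace_\<Omega> D_def by (intro exI[of _ U] exI[of _ h]) (simp add: h_def)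
qed

end

section \<open>Choosing the deformation for given prototiles\<close>

lemma finite_extreme_points_simplex:
  fixes S :: "'a::euclidean_space set"
  assumes "n simplex S"
  shows "finite {v. v extreme_point_of S}"
proof -
  obtain V where V: "\<not> affine_dependent V" "S = convex hull V"
    using assms unfolding simplex_def by blast
  then show ?thesis
    using extreme_point_of_convex_hull_affine_independent[OF V(1)] aff_independent_finite by simp
qed

text \<open>The shapes of the simplices fix the distortion constants first; only then is the
  accuracy of \<open>\<Phi>\<close> chosen, and \<open>N\<close> comes with it.\<close>

lemma lattice_deformation_exists:
  fixes Pr :: "('n::finite, 'm) tile set" and P :: "('n, 'm) tiling set"
  assumes "finite Pr" "\<forall>t\<in>Pr. prototile t" "tiling_space Pr P"
  obtains \<Phi> N where "lattice_deformation Pr P \<Phi> N"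
proof -
  define \<S> where "\<S> = \<Union>(fst ` Pr)"
  define V where "V S = {v :: real ^ 'n. v extreme_point_of S}" for S
  define D where "D = (\<Union>S\<in>\<S>. (\<lambda>(v, w). v - w) ` (V S \<times> V S))"
  have complex: "simplicial_complex (fst p)" if "p \<in> Pr" for p
    using assms(2) that by (simp add: prototile_def triangulation_of_def)
  have fin\<S>: "finite \<S>"
    unfolding \<S>_def using assms(1) complex by (auto simp: simplicial_complex_def)
  have simplex: "\<exists>n. n simplex S" if "S \<in> \<S>" for S
    using that complex unfolding \<S>_def simplicial_complex_def by blast
  have "finite (V S)" if "S \<in> \<S>" for S
    unfolding V_def using simplex[OF that] finite_extreme_points_simplex by blast
  then have finD: "finite D" unfolding D_def using fin\<S> by blast
  have "\<exists>C\<ge>0. \<forall>f N \<eta> x y x' y'. (\<forall>v\<in>V S. \<forall>w\<in>V S. norm (f v - f w - N *\<^sub>R (v - w)) \<le> \<eta>) \<longrightarrow>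
      (x, y) \<in> affine_graph f S \<longrightarrow> (x', y') \<in> affine_graph f S \<longrightarrow>
      norm (y - y' - N *\<^sub>R (x - x')) \<le> C * \<eta> * norm (x - x')" if S: "S \<in> \<S>" for S
  proof -
    obtain n where "n simplex S" using simplex[OF S] by blast
    then obtain C where C: "0 \<le> C" "\<And>f N \<eta> x y x' y'.
      (\<And>v w. v extreme_point_of S \<Longrightarrow> w extreme_point_of S \<Longrightarrow>
         norm (f v - f w - N *\<^sub>R (v - w)) \<le> \<eta>) \<Longrightarrow>
      (x, y) \<in> affine_graph f S \<Longrightarrow> (x', y') \<in> affine_graph f S \<Longrightarrow>
      norm (y - y' - N *\<^sub>R (x - x')) \<le> C * \<eta> * norm (x - x')"
      by (rule affine_graph_near_scaling) blast
    show ?thesis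
      by (intro exI[of _ C] conjI allI impI C) (auto simp: V_def)
  qed
  then obtain C where C: "\<And>S. S \<in> \<S> \<Longrightarrow> 0 \<le> C S"
    "\<And>S f N \<eta> x y x' y'. S \<in> \<S> \<Longrightarrow> \<forall>v\<in>V S. \<forall>w\<in>V S. norm (f v - f w - N *\<^sub>R (v - w)) \<le> \<eta> \<Longrightarrow>
      (x, y) \<in> affine_graph f S \<Longrightarrow> (x', y') \<in> affine_graph f S \<Longrightarrow>
      norm (y - y' - N *\<^sub>R (x - x')) \<le> C S * \<eta> * norm (x - x')"
    by metis
  define M where "M = 1 + sum C \<S>"
  have M: "0 < M" unfolding M_def using C(1) by (intro add_pos_nonneg sum_nonneg) auto
  have CM: "C S \<le> M" if "S \<in> \<S>" for S
    unfolding M_def using member_le_sum[OF that, of C] C(1) fin\<S> by fastforce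
  \<comment> \<open>With edge error \<open>N * (1 / (2 * M))\<close> and distortion at most
    \<open>M\<close>, the total error factor is the required \<open>N / 2\<close>.\<close>
  have "0 < 1 / (2 * M)" using M by simp
  then obtain \<Phi> :: "real ^ 'n \<Rightarrow> real ^ 'n" and N where \<Phi>: "\<And>x y. \<Phi> (x + y) = \<Phi> x + \<Phi> y" "0 < N"
    "\<And>x. x \<in> D \<Longrightarrow> \<Phi> x \<in> int_lattice" "\<And>x. x \<in> D \<Longrightarrow> norm (\<Phi> x - N *\<^sub>R x) \<le> N * (1 / (2 * M))"
    using additive_lattice_approximation[OF finD] by metis
  have diff: "\<Phi> v - \<Phi> w = \<Phi> (v - w)" for v w using \<Phi>(1)[of "v - w" w] by simp
  have inD: "v - w \<in> D" if "S \<in> \<S>" "v \<in> V S" "w \<in> V S" for S v w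
    unfolding D_def using that by force
  have "lattice_deformation Pr P \<Phi> N"
  proof
    show "finite Pr" by (rule assms(1))
    show "prototile p" if "p \<in> Pr" for p using that assms(2) by blast
    show "closedin (tiling_topology Pr) P" using assms(3) by (simp add: tiling_space_def)
    show "translate_tiling u T \<in> P" if "T \<in> P" for T u
      using that assms(3) by (simp add: tiling_space_def)
    show "\<Phi> (x + y) = \<Phi> x + \<Phi> y" for x y by (rule \<Phi>(1))
    show "0 < N" by (rule \<Phi>(2))
    fix p S assume "p \<in> Pr" "S \<in> fst p"
    then have S: "S \<in> \<S>" unfolding \<S>_def by blast
    show "\<Phi> v - \<Phi> w \<in> int_lattice" if "v extreme_point_of S" "w extreme_point_of S" for v w
      unfolding diff using that by (intro \<Phi>(3) inD[OF S]) (auto simp: V_def)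
    fix x y x' y' assume G: "(x, y) \<in> affine_graph \<Phi> S" "(x', y') \<in> affine_graph \<Phi> S"
    have "norm (\<Phi> v - \<Phi> w - N *\<^sub>R (v - w)) \<le> N * (1 / (2 * M))" if "v \<in> V S" "w \<in> V S" for v w
      unfolding diff using that by (intro \<Phi>(4) inD[OF S])
    then have "norm (y - y' - N *\<^sub>R (x - x')) \<le> C S * (N * (1 / (2 * M))) * norm (x - x')"
      using C(2)[OF S _ G] by blast
    also have "\<dots> \<le> M * (N * (1 / (2 * M))) * norm (x - x')"
      using CM[OF S] M \<Phi>(2) by (intro mult_right_mono) auto
    finally show "norm (y - y' - N *\<^sub>R (x - x')) \<le> N / 2 * norm (x - x')" using M by simp
  qed
  then show ?thesis by (rule that)
qed

theorem theorem1:
  fixes Pr :: "('n::finite, 'm) tile set"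
    and P :: "('n, 'm) tiling set"
  assumes "finite Pr"
    and "\<forall>t \<in> Pr. prototile t"
    and "tiling_space Pr P"
  shows "\<exists>(F :: ('n, 'm) tiling topology) (p :: ('n, 'm) tiling \<Rightarrow> (real ^ 'n) set).
           totally_disconnected_space F \<and>
           fiber_bundle (subtopology (tiling_topology Pr) P) torus F p"
proof -
  obtain \<Phi> N where "lattice_deformation Pr P \<Phi> N"
    using lattice_deformation_exists[OF assms] .
  then show ?thesis
    using lattice_deformation.totally_disconnected_fiber lattice_deformation.phase_bundle by blast
qed

end
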